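(* Let $p$ be a prime and let $G$ be a finite non-abelian $p$-group such that $C_G(Z(\Phi(G)))=\Phi(G)$. Suppose that one of the following conditions holds: (1) $p$ is odd and $\mathrm{rk}(G/Z(G))<\binom{\mathrm{d}(G)+1}{2}\,\mathrm{d}(Z(G))$; (2) $p=2$ and $\mathrm{rk}(G/Z(G))<\binom{\mathrm{d}(G)}{2}\,\mathrm{d}(Z(G))$. Then $G$ has a non-inner automorphism of order $p$ that fixes every element of $\Phi(G)$.
   Context: For a finite group $H$: $\mathrm{d}(H)$ is the minimum number of generators of $H$; $\mathrm{rk}(H)$, the rank of $H$, is the minimum number $r$ such that every subgroup of $H$ can be generated by at most $r$ elements; $Z(H)$ is the center and $\Phi(H)$ the Frattini subgroup. $C_G(K)$ is the centralizer of $K$ in $G$. *)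

theory Defs
  imports "HOL-Algebra.Algebra"
begin

(* A subgroup K of G, viewed as a group in its own right, is G\<lparr>carrier := K\<rparr>. *)

definition centralizer :: "('a, 'b) monoid_scheme \<Rightarrow> 'a set \<Rightarrow> 'a set" where
  "centralizer G K =
     {x \<in> carrier G. \<forall>y\<in>K. x \<otimes>\<^bsub>G\<^esub> y = y \<otimes>\<^bsub>G\<^esub> x}"

definition center :: "('a, 'b) monoid_scheme \<Rightarrow> 'a set" where
  "center G = centralizer G (carrier G)"

definition maximal_subgroup :: "'a set \<Rightarrow> ('a, 'b) monoid_scheme \<Rightarrow> bool" where
  "maximal_subgroup M G \<longleftrightarrow>
     subgroup M G \<and> M \<noteq> carrier G \<and>
     (\<forall>K. subgroup K G \<longrightarrow> M \<subseteq> K \<longrightarrow> K = M \<or> K = carrier G)"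

(* Intersecting with the carrier makes the subgroup the whole group when there is no
   maximal subgroup. *)
definition frattini :: "('a, 'b) monoid_scheme \<Rightarrow> 'a set" where
  "frattini G = carrier G \<inter> \<Inter>{M. maximal_subgroup M G}"

(* d(H); only meaningful for finitely generated H, as LEAST is unspecified otherwise. *)
definition min_gens :: "('a, 'b) monoid_scheme \<Rightarrow> nat" where
  "min_gens H =
     (LEAST n. \<exists>S. S \<subseteq> carrier H \<and> finite S \<and> card S = n \<and> generate H S = carrier H)"

(* rk(H); only meaningful for H of finite rank, in particular for finite H. *)
definition group_rank :: "('a, 'b) monoid_scheme \<Rightarrow> nat" where
  "group_rank H =
     (LEAST r. \<forall>K. subgroup K H \<longrightarrow>
        (\<exists>S. S \<subseteq> K \<and> finite S \<and> card S \<le> r \<and> generate H S = K))"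

(* Restricted to the carrier, because the elements of auto G are extensional functions. *)
definition inner_auto :: "('a, 'b) monoid_scheme \<Rightarrow> ('a \<Rightarrow> 'a) set" where
  "inner_auto G =
     {\<lambda>x\<in>carrier G. g \<otimes>\<^bsub>G\<^esub> x \<otimes>\<^bsub>G\<^esub> inv\<^bsub>G\<^esub> g | g. g \<in> carrier G}"

end

theory Submission
  imports Defs "HOL-Number_Theory.Cong"
begin

text \<open>
  Let \<open>\<Phi> = \<Phi>(G)\<close>, \<open>A = Z(\<Phi>)\<close>, \<open>Q = G/\<Phi>\<close> (elementary abelian of rank \<open>k = d(G)\<close>), and let \<open>W\<close> be
  the elements of order dividing \<open>p\<close> in \<open>Z(G)\<close>. As \<open>C(A) = \<Phi>\<close>, the automorphisms that fix \<open>\<Phi>\<close>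
  elementwise and have order dividing \<open>p\<close> are the maps \<open>x \<mapsto> f(x) x\<close> with \<open>f\<close> a 1-cocycle of \<open>Q\<close> with
  values in the elements of order dividing \<open>p\<close> in \<open>A\<close>. If all of them are inner, they are induced by
  elements of an elementary abelian subgroup of \<open>G/Z(G)\<close>, so there are at most \<open>p\<close> to the power
  \<open>rk(G/Z(G))\<close> cocycles.

  On the other hand, every symmetric bilinear map \<open>\<beta> : Q \<times> Q \<rightarrow> W\<close> (alternating if \<open>p = 2\<close>) gives for
  each basis vector \<open>e\<^sub>i\<close> of \<open>Q\<close> a homomorphism \<open>\<beta>(e\<^sub>i, -)\<close>, which is a cocycle and hence a commutator
  map \<open>x \<mapsto> [x, a\<^sub>i]\<close> with \<open>a\<^sub>i \<in> A\<close> and \<open>a\<^sub>i\<^sup>p \<in> Z(G)\<close>. The \<open>a\<^sub>i\<close> are determined up to \<open>Z(G)\<close>, so by the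
  pigeonhole principle at least \<open>|W|\<^sup>N\<close> pairs \<open>(\<beta>, (a\<^sub>i))\<close> share the same \<open>p\<close>-th powers, where \<open>N\<close> is
  the number of coefficients of \<open>\<beta>\<close>. Dividing by one fixed pair makes all \<open>a\<^sub>i\<close> of order dividing
  \<open>p\<close>, and then some cocycle has second difference \<open>\<beta>\<close> and, up to \<open>W\<close>, the value \<open>a\<^sub>i\<close> at \<open>e\<^sub>i\<close>.
  So there are at least \<open>|W|\<^sup>N\<close> cocycles, with \<open>|W| \<ge> p\<close> to the power \<open>d(Z(G))\<close>, and \<open>N\<close> is
  \<open>(k + 1) choose 2\<close> for odd \<open>p\<close> and \<open>k choose 2\<close> for \<open>p = 2\<close>.
\<close>

section \<open>Maximal subgroups of p-groups\<close>

text \<open>The points that are not fixed split into orbits whose sizes divide \<open>p ^ n\<close>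
  but differ from 1. Each such size is therefore a multiple of \<open>p\<close>.\<close>

lemma prime_dvd_card_minus_fixed_points:
  fixes p :: nat
  assumes "group_action G E \<phi>" and "Factorial_Ring.prime p" and "order G = p ^ n" and "finite E"
  shows "p dvd card (E - {x \<in> E. \<forall>g\<in>carrier G. \<phi> g x = x})"
proof -
  interpret group_action G E \<phi> by fact
  define F where "F = {x \<in> E. \<forall>g\<in>carrier G. \<phi> g x = x}"
  define C where "C = orbit G \<phi> ` (E - F)"
  have self: "x \<in> orbit G \<phi> x" if "x \<in> E" for x
    using orbit_refl that by blast
  have C_sub: "C \<subseteq> orbits G E \<phi>"
    by (auto simp: C_def orbits_def)
  have small: "orbit G \<phi> x \<subseteq> E - F" if x: "x \<in> E - F" for x
  proof
    fix y assume y: "y \<in> orbit G \<phi> x"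
    then have yE: "y \<in> E"
      using element_image x unfolding orbit_def by blast
    moreover have "y \<notin> F"
    proof
      assume "y \<in> F"
      then have fix_y: "\<phi> g y = y" if "g \<in> carrier G" for g
        using that by (auto simp: F_def)
      have "x \<in> orbit G \<phi> y"
        using orbit_sym[of x y] x yE y by auto
      then have "x = y"
        using fix_y unfolding orbit_def by auto
      with x \<open>y \<in> F\<close> show False by auto
    qed
    ultimately show "y \<in> E - F" by auto
  qed
  have Union: "\<Union>C = E - F"
    using small self unfolding C_def by blast
  have "p dvd card (\<Union>C)"
  proof (rule dvd_partition)
    show "finite (\<Union>C)" using assms(4) Union by simp
    show "\<forall>c\<in>C. p dvd card c"
    proof
      fix c assume "c \<in> C"
      then obtain x where x: "x \<in> E - F" "c = orbit G \<phi> x" by (auto simp: C_def)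
      have "card c dvd p ^ n"
        using orbit_stabilizer_theorem[of x] x assms(3) by (metis DiffD1 dvd_triv_left)
      then obtain i where i: "card c = p ^ i"
        using assms(2) by (auto simp: divides_primepow_nat)
      have "card c \<noteq> 1"
      proof
        assume "card c = 1"
        then have "c = {x}"
          using self[of x] x by (metis DiffD1 card_1_singletonE singletonD)
        then have "\<phi> g x = x" if "g \<in> carrier G" for g
          using x(2) that unfolding orbit_def by blast
        with x(1) show False by (auto simp: F_def)
      qed
      then show "p dvd card c" using i by (cases i) auto
    qed
    show "\<forall>c1\<in>C. \<forall>c2\<in>C. c1 \<noteq> c2 \<longrightarrow> c1 \<inter> c2 = {}"
      using disjoint_union C_sub by blast
  qed
  then show ?thesis by (simp add: Union F_def)
qed

context group
begin

lemma inv_cancel_left: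
  assumes "a \<in> carrier G" and "x \<in> carrier G"
  shows "a \<otimes> (inv a \<otimes> x) = x" and "inv a \<otimes> (a \<otimes> x) = x"
  using assms by (simp_all flip: m_assoc)

text \<open>Multiplying right cosets from the right reverses products; the inverse in
  \<open>C #> inv h\<close> turns this into a left action. It is used with \<open>H = M\<close>,
  where a fixed coset corresponds to an element normalizing \<open>M\<close>.\<close>

lemma rcosets_action:
  assumes "subgroup H G" and "subgroup M G"
  shows "group_action (G\<lparr>carrier := H\<rparr>) (rcosets M) (\<lambda>h. \<lambda>C\<in>rcosets M. C #> inv h)"
proof -
  have sub: "C \<subseteq> carrier G" if "C \<in> rcosets M" for C
    using that assms(2) subgroup.rcosets_carrier is_group by metis
  have closed: "C #> h \<in> rcosets M" if C: "C \<in> rcosets M" and h: "h \<in> carrier G" for C h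
  proof -
    obtain g where g: "g \<in> carrier G" "C = M #> g"
      using C by (auto simp: RCOSETS_def)
    then have "C #> h = M #> (g \<otimes> h)"
      using assms(2) h coset_mult_assoc subgroup.subset by metis
    then show ?thesis
      using g h assms(2) rcosetsI[of M "g \<otimes> h"] by (simp add: subgroup.subset)
  qed
  have HG: "h \<in> carrier G" if "h \<in> H" for h
    using that assms(1) subgroup.mem_carrier by metis
  have bij: "bij_betw (\<lambda>C\<in>rcosets M. C #> inv h) (rcosets M) (rcosets M)" if h: "h \<in> H" for h
  proof (rule bij_betw_byWitness[where f' = "\<lambda>C. C #> h"])
    show "\<forall>a\<in>rcosets M. (\<lambda>C\<in>rcosets M. C #> inv h) a #> h = a"
      using sub HG[OF h] by (simp add: coset_mult_assoc)
    show "\<forall>a'\<in>rcosets M. (\<lambda>C\<in>rcosets M. C #> inv h) (a' #> h) = a'"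
      using sub HG[OF h] closed by (simp add: coset_mult_assoc)
  qed (use closed HG[OF h] in auto)
  show ?thesis
  proof (intro group_action.intro group_hom.intro group_hom_axioms.intro)
    show "group (G\<lparr>carrier := H\<rparr>)"
      using assms(1) by (rule subgroup_imp_group)
    show "group (BijGroup (rcosets M))"
      by (rule group_BijGroup)
    show "(\<lambda>h. \<lambda>C\<in>rcosets M. C #> inv h) \<in> hom (G\<lparr>carrier := H\<rparr>) (BijGroup (rcosets M))"
    proof (rule homI)
      fix x y assume xy: "x \<in> carrier (G\<lparr>carrier := H\<rparr>)" "y \<in> carrier (G\<lparr>carrier := H\<rparr>)"
      then have "(\<lambda>C\<in>rcosets M. C #> inv x) \<in> Bij (rcosets M)"
        "(\<lambda>C\<in>rcosets M. C #> inv y) \<in> Bij (rcosets M)"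
        using bij by (auto simp: Bij_def)
      then show "(\<lambda>C\<in>rcosets M. C #> inv (x \<otimes>\<^bsub>G\<lparr>carrier := H\<rparr>\<^esub> y)) =
        (\<lambda>C\<in>rcosets M. C #> inv x) \<otimes>\<^bsub>BijGroup (rcosets M)\<^esub> (\<lambda>C\<in>rcosets M. C #> inv y)"
        using xy sub HG closed
        by (auto simp: BijGroup_def compose_def fun_eq_iff coset_mult_assoc inv_mult_group)
    qed (use bij in \<open>auto simp: BijGroup_def Bij_def\<close>)
  qed
qed

text \<open>Let \<open>M\<close> act on its own right cosets. Their number is a positive power of
  \<open>p\<close>, so \<open>p\<close> divides the number of fixed cosets. As \<open>M\<close>
  itself is fixed, there is another fixed coset, and its representative normalizes \<open>M\<close>
  without lying in it.\<close>

lemma p_group_normalizer_grows: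
  fixes p :: nat
  assumes "Factorial_Ring.prime p" and "order G = p ^ n" and "subgroup M G" and "M \<noteq> carrier G"
  shows "\<exists>g\<in>carrier G - M. \<forall>m\<in>M. g \<otimes> m \<otimes> inv g \<in> M"
proof -
  interpret M: subgroup M G by fact
  have fin: "finite (carrier G)"
    using assms(1,2) order_gt_0_iff_finite prime_gt_0_nat by auto
  have dvd: "card M dvd p ^ n" "card (rcosets M) dvd p ^ n"
    using lagrange[OF assms(3)] assms(2) by (metis dvd_triv_right, metis dvd_triv_left)
  obtain i where i: "card M = p ^ i"
    using dvd(1) assms(1) by (auto simp: divides_primepow_nat)
  obtain j where j: "card (rcosets M) = p ^ j"
    using dvd(2) assms(1) by (auto simp: divides_primepow_nat)
  have finR: "finite (rcosets M)"
    using fin finite_subset[OF rcosets_subset_PowG[OF assms(3)]] by simp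
  define \<phi> where "\<phi> = (\<lambda>h. \<lambda>C\<in>rcosets M. C #> inv h)"
  define F where "F = {C \<in> rcosets M. \<forall>h\<in>M. \<phi> h C = C}"
  have "j \<noteq> 0"
  proof
    assume "j = 0"
    then have "card M = card (carrier G)"
      using lagrange[OF assms(3)] j by (simp add: order_def)
    then show False
      using card_subset_eq[OF fin M.subset] assms(4) by simp
  qed
  then have "p dvd card (rcosets M)" using j by (cases j) auto
  moreover have "p dvd card (rcosets M - F)"
    unfolding F_def
    using prime_dvd_card_minus_fixed_points[OF rcosets_action[OF assms(3,3)] assms(1) _ finR, of i] i
    by (simp add: order_def \<phi>_def)
  moreover have "card (rcosets M) = card F + card (rcosets M - F)"
    using finR by (metis (no_types, lifting) F_def card_Diff_subset card_mono finite_subset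
        le_add_diff_inverse mem_Collect_eq subsetI)
  ultimately have "p dvd card F"
    by (metis dvd_add_left_iff)
  have fixed: "C #> inv m = C" if "C \<in> F" "m \<in> M" for C m
    using that by (auto simp: F_def \<phi>_def)
  have MF: "M \<in> F"
    using M.subgroup_in_rcosets[OF is_group] M.rcos_const[OF is_group]
    by (auto simp: F_def \<phi>_def)
  \<comment> \<open>A singleton would have cardinality 1, which \<open>p\<close> does not
    divide.\<close>
  have "F \<noteq> {M}"
    using \<open>p dvd card F\<close> assms(1) by (auto simp: prime_nat_iff)
  then obtain C where C: "C \<in> F" "C \<noteq> M" using MF by blast
  then obtain g where g: "g \<in> carrier G" "C = M #> g"
    by (auto simp: F_def RCOSETS_def)
  have "g \<notin> M" using g C(2) M.rcos_const[OF is_group] by auto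
  moreover have "g \<otimes> m \<otimes> inv g \<in> M" if m: "m \<in> M" for m
  proof -
    have "M #> (g \<otimes> m) = M #> g"
      using fixed[OF C(1), of "inv m"] m g by (simp add: coset_mult_assoc M.subset)
    then have "g \<otimes> m \<in> M #> g"
      using rcos_self[of "g \<otimes> m" M] g m assms(3) by simp
    then show ?thesis
      using g m M.rcos_module_imp[OF is_group, of g "g \<otimes> m"] by simp
  qed
  ultimately show ?thesis using g by blast
qed

text \<open>The normalizer of \<open>M\<close> is a subgroup strictly above \<open>M\<close>, so
  maximality makes it the whole group.\<close>

lemma maximal_subgroup_normal:
  fixes p :: nat
  assumes "Factorial_Ring.prime p" and "order G = p ^ n" and "maximal_subgroup M G"
  shows "M \<lhd> G"
proof -
  have M: "subgroup M G" "M \<noteq> carrier G"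
    "\<And>K. subgroup K G \<Longrightarrow> M \<subseteq> K \<Longrightarrow> K = M \<or> K = carrier G"
    using assms(3) by (auto simp: maximal_subgroup_def)
  interpret M: subgroup M G by fact
  have fin: "finite (carrier G)"
    using assms(1,2) order_gt_0_iff_finite prime_gt_0_nat by auto
  then have finM: "finite M" using M.subset finite_subset by blast
  define N where "N = {g \<in> carrier G. \<forall>x\<in>carrier G. g \<otimes> x \<otimes> inv g \<in> M \<longleftrightarrow> x \<in> M}"
  have "subgroup N G"
  proof (rule subgroupI)
    fix a assume a: "a \<in> N"
    then have aG: "a \<in> carrier G" by (simp add: N_def)
    have "inv a \<otimes> x \<otimes> inv (inv a) \<in> M \<longleftrightarrow> x \<in> M" if x: "x \<in> carrier G" for x
    proof -
      have "a \<otimes> (inv a \<otimes> x \<otimes> inv (inv a)) \<otimes> inv a = x"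
        using aG x by (simp add: m_assoc inv_cancel_left)
      moreover have "inv a \<otimes> x \<otimes> inv (inv a) \<in> carrier G"
        using aG x by simp
      moreover have "\<And>y. y \<in> carrier G \<Longrightarrow> a \<otimes> y \<otimes> inv a \<in> M \<longleftrightarrow> y \<in> M"
        using a by (simp add: N_def)
      ultimately show ?thesis by metis
    qed
    then show "inv a \<in> N" using aG by (simp add: N_def)
  next
    fix a b assume ab: "a \<in> N" "b \<in> N"
    then have abG: "a \<in> carrier G" "b \<in> carrier G" by (auto simp: N_def)
    have "(a \<otimes> b) \<otimes> x \<otimes> inv (a \<otimes> b) = a \<otimes> (b \<otimes> x \<otimes> inv b) \<otimes> inv a" if "x \<in> carrier G" for x
      using abG that by (simp add: m_assoc inv_mult_group)
    then show "a \<otimes> b \<in> N" using ab abG by (simp add: N_def)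
  next
    show "N \<noteq> {}" using one_closed by (auto simp: N_def)
  qed (auto simp: N_def)
  \<comment> \<open>Conjugation is injective and \<open>M\<close> is finite, so mapping
    \<open>M\<close> into itself already means mapping it onto itself. This gives the equivalence in
    the definition of \<open>N\<close>.\<close>
  moreover have in_N: "g \<in> N" if g: "g \<in> carrier G" "\<forall>m\<in>M. g \<otimes> m \<otimes> inv g \<in> M" for g
  proof -
    have "inj_on (\<lambda>m. g \<otimes> m \<otimes> inv g) M"
      by (rule inj_onI) (use g in simp)
    then have img: "(\<lambda>m. g \<otimes> m \<otimes> inv g) ` M = M"
      using g finM by (intro endo_inj_surj) auto
    have "x \<in> M" if x: "x \<in> carrier G" "g \<otimes> x \<otimes> inv g \<in> M" for x
    proof -
      obtain m where "m \<in> M" "g \<otimes> m \<otimes> inv g = g \<otimes> x \<otimes> inv g"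
        using x(2) img by (metis (no_types, lifting) imageE)
      then show ?thesis using g x by simp
    qed
    then show ?thesis using g unfolding N_def by blast
  qed
  moreover have "M \<subseteq> N" using in_N by auto
  moreover obtain g where "g \<in> carrier G - M" "\<forall>m\<in>M. g \<otimes> m \<otimes> inv g \<in> M"
    using p_group_normalizer_grows[OF assms(1,2) M(1,2)] by blast
  ultimately have "N = carrier G" using M(3) by blast
  then have "x \<otimes> h \<otimes> inv x \<in> M" if "x \<in> carrier G" "h \<in> M" for x h
    using that M.mem_carrier[of h] unfolding N_def by blast
  then show ?thesis
    using M(1) unfolding normal_inv_iff by blast
qed

text \<open>The quotient by \<open>M\<close> is cyclic of order \<open>p\<close>, and
  \<open>c\<close> is the discrete logarithm on it with respect to a chosen generator.\<close>

lemma maximal_subgroup_coordinate: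
  fixes p :: nat
  assumes "Factorial_Ring.prime p" and "order G = p ^ n" and "maximal_subgroup M G"
  shows "\<exists>c :: 'a \<Rightarrow> int.
    (\<forall>x\<in>carrier G. \<forall>y\<in>carrier G. [c (x \<otimes> y) = c x + c y] (mod int p)) \<and>
    (\<forall>x\<in>carrier G. x \<in> M \<longleftrightarrow> int p dvd c x)"
proof -
  have M: "subgroup M G" "M \<noteq> carrier G"
    "\<And>K. subgroup K G \<Longrightarrow> M \<subseteq> K \<Longrightarrow> K = M \<or> K = carrier G"
    using assms(3) by (auto simp: maximal_subgroup_def)
  interpret M: normal M G using maximal_subgroup_normal[OF assms] .
  obtain g0 where g0: "g0 \<in> carrier G" "g0 \<notin> M" using M(2) M.subset by blast
  \<comment> \<open>Stopping one power of \<open>p\<close> before \<open>M\<close> is reached yields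
    an element \<open>g\<close> outside \<open>M\<close> whose \<open>p\<close>-th power lies in
    \<open>M\<close>.\<close>
  define j where "j = (LEAST j. g0 [^] (p ^ j) \<in> M)"
  have "g0 [^] (p ^ n) \<in> M"
    using pow_order_eq_1[OF g0(1)] assms(2) by simp
  then have j: "g0 [^] (p ^ j) \<in> M" "\<And>i. i < j \<Longrightarrow> g0 [^] (p ^ i) \<notin> M"
    unfolding j_def by (auto intro: LeastI dest: not_less_Least)
  then obtain i where i: "j = Suc i" using g0 by (cases j) auto
  define g where "g = g0 [^] (p ^ i)"
  have g: "g \<in> carrier G" "g \<notin> M" "g [^] p \<in> M"
    using j i g0(1) by (auto simp: g_def nat_pow_pow mult.commute)
  have pow_iff: "g [^] (a :: int) \<in> M \<longleftrightarrow> int p dvd a" for a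
  proof
    assume "int p dvd a"
    then obtain b where "a = int p * b" by auto
    then have "g [^] a = (g [^] int p) [^] b"
      using int_pow_pow[OF g(1)] by simp
    then show "g [^] a \<in> M"
      using g(3) subgroup_int_pow_closed[OF M(1)] by (simp add: int_pow_int)
  next
    assume a: "g [^] a \<in> M"
    show "int p dvd a"
    proof (rule ccontr)
      assume "\<not> int p dvd a"
      then have "coprime (int p) a"
        using assms(1) by (simp add: prime_imp_coprime)
      then obtain u v where "u * int p + v * a = 1"
        using bezout_int[of "int p" a] by auto
      then have "g = g [^] (int p * u + a * v)"
        using g(1) by (simp add: mult.commute)
      also have "\<dots> = (g [^] int p) [^] u \<otimes> (g [^] a) [^] v"
        using int_pow_pow[OF g(1)] int_pow_mult[OF g(1)] by simp
      also have "\<dots> \<in> M"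
        using a g(3) subgroup_int_pow_closed[OF M(1)] by (simp add: int_pow_int)
      finally show False using g(2) by simp
    qed
  qed
  define K where "K = generate G {g}"
  have "subgroup K G" unfolding K_def using g(1) by (intro generate_is_subgroup) auto
  then interpret S: second_isomorphism_grp M G K
    using M.normal_axioms
    by (simp add: second_isomorphism_grp_def second_isomorphism_grp_axioms_def)
  have "g \<in> M <#> K"
    using S.S_contained_in_set_mult generate.incl[of g "{g}" G] unfolding K_def by auto
  \<comment> \<open>The product contains \<open>M\<close> and the element \<open>g\<close> outside
    it, so maximality applies.\<close>
  then have "M <#> K = carrier G"
    using M(3)[OF S.normal_set_mult_subgroup S.H_contained_in_set_mult] g(2) by auto
  then have decomp: "\<exists>a :: int. \<exists>m\<in>M. x = m \<otimes> g [^] a" if "x \<in> carrier G" for x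
    using that generate_pow[OF g(1)] unfolding K_def set_mult_def by (simp add: set_eq_iff) blast
  \<comment> \<open>The exponent is unique only modulo \<open>p\<close>. The arbitrary choice makes
    \<open>c\<close> additive up to congruence.\<close>
  define c where "c x = (SOME a :: int. \<exists>m\<in>M. x = m \<otimes> g [^] a)" for x
  have c: "\<exists>m\<in>M. x = m \<otimes> g [^] c x" if "x \<in> carrier G" for x
    unfolding c_def using decomp[OF that] by (rule someI_ex)
  have "[c (x \<otimes> y) = c x + c y] (mod int p)" if x: "x \<in> carrier G" and y: "y \<in> carrier G" for x y
  proof -
    obtain m where m: "m \<in> M" "x = m \<otimes> g [^] c x" using c[OF x] by auto
    obtain m' where m': "m' \<in> M" "y = m' \<otimes> g [^] c y" using c[OF y] by auto
    obtain m'' where m'': "m'' \<in> M" "x \<otimes> y = m'' \<otimes> g [^] c (x \<otimes> y)"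
      using c[of "x \<otimes> y"] x y by auto
    \<comment> \<open>Normality of \<open>M\<close> allows \<open>m'\<close> to be moved to the left
      past the power of \<open>g\<close>, at the cost of replacing it by \<open>h\<close>.\<close>
    define h where "h = g [^] c x \<otimes> m' \<otimes> inv (g [^] c x)"
    have h: "h \<in> M"
      unfolding h_def using M.inv_op_closed2[of "g [^] c x" m'] m'(1) g(1) by simp
    have "m'' \<otimes> g [^] c (x \<otimes> y) = m \<otimes> g [^] c x \<otimes> (m' \<otimes> g [^] c y)"
      using m''(2) m(2) m'(2) by simp
    also have "\<dots> = m \<otimes> (h \<otimes> g [^] (c x + c y))"
      using m(1) m'(1) g(1) by (simp add: h_def m_assoc int_pow_mult inv_solve_left)
    finally have eq: "m'' \<otimes> g [^] c (x \<otimes> y) = m \<otimes> (h \<otimes> g [^] (c x + c y))" .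
    have "g [^] (c (x \<otimes> y) - (c x + c y)) = g [^] c (x \<otimes> y) \<otimes> inv (g [^] (c x + c y))"
      using g(1) by (simp add: int_pow_diff)
    also have "g [^] c (x \<otimes> y) = inv m'' \<otimes> (m \<otimes> (h \<otimes> g [^] (c x + c y)))"
      using eq m''(1) m(1) h g(1) by (simp add: inv_solve_left)
    also have "\<dots> \<otimes> inv (g [^] (c x + c y)) = inv m'' \<otimes> (m \<otimes> h)"
      using m''(1) m(1) h g(1) by (simp add: m_assoc)
    also have "\<dots> \<in> M" using m''(1) m(1) h by simp
    finally show ?thesis
      using pow_iff by (simp add: cong_iff_dvd_diff)
  qed
  moreover have "x \<in> M \<longleftrightarrow> int p dvd c x" if x: "x \<in> carrier G" for x
  proof -
    obtain m where m: "m \<in> M" "x = m \<otimes> g [^] c x" using c[OF x] by auto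
    have "x \<in> M \<longleftrightarrow> g [^] c x \<in> M"
    proof
      assume "x \<in> M"
      then have "inv m \<otimes> x \<in> M" using m(1) by simp
      moreover have "inv m \<otimes> x = g [^] c x"
        using m x g(1) inv_solve_left'[of "g [^] c x" m x] by simp
      ultimately show "g [^] c x \<in> M" by simp
    next
      assume "g [^] c x \<in> M"
      then show "x \<in> M" using m M.m_closed by metis
    qed
    then show ?thesis using pow_iff by simp
  qed
  ultimately show ?thesis by blast
qed

end

section \<open>Coordinates modulo the Frattini subgroup\<close>

text \<open>Homomorphisms to the integers modulo \<open>p\<close>, represented by integer-valued
  functions so that their values can be multiplied and used as exponents.\<close>

definition hom_mod :: "nat \<Rightarrow> ('a, 'b) monoid_scheme \<Rightarrow> ('a \<Rightarrow> int) \<Rightarrow> bool" where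
  "hom_mod p G c \<longleftrightarrow>
     (\<forall>x\<in>carrier G. \<forall>y\<in>carrier G. [c (x \<otimes>\<^bsub>G\<^esub> y) = c x + c y] (mod int p))"

context group
begin

lemma hom_mod_mult:
  "hom_mod p G c \<Longrightarrow> x \<in> carrier G \<Longrightarrow> y \<in> carrier G \<Longrightarrow> [c (x \<otimes> y) = c x + c y] (mod int p)"
  unfolding hom_mod_def by blast

lemma hom_mod_one:
  assumes "hom_mod p G c" shows "[c \<one> = 0] (mod int p)"
proof -
  have "[c \<one> + 0 = c \<one> + c \<one>] (mod int p)"
    using hom_mod_mult[OF assms one_closed one_closed] by simp
  then show ?thesis
    unfolding cong_add_lcancel by (rule cong_sym)
qed

lemma hom_mod_pow:
  fixes n :: nat
  assumes "hom_mod p G c" and "x \<in> carrier G"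
  shows "[c (x [^] n) = int n * c x] (mod int p)"
proof (induction n)
  case 0
  show ?case using hom_mod_one[OF assms(1)] by simp
next
  case (Suc n)
  have "[c (x [^] Suc n) = c (x [^] n) + c x] (mod int p)"
    using hom_mod_mult[OF assms(1)] assms(2) by simp
  also have "[c (x [^] n) + c x = int n * c x + c x] (mod int p)"
    using Suc.IH by (simp add: cong_add_rcancel)
  also have "int n * c x + c x = int (Suc n) * c x"
    by (simp add: algebra_simps)
  finally show ?case .
qed

text \<open>By induction on the index set: multiplying by a power of \<open>y j\<close> corrects the
  coordinate \<open>j\<close> and leaves the others unchanged modulo \<open>p\<close>.\<close>

lemma hom_mod_realize:
  assumes "\<And>i. i \<in> I \<Longrightarrow> hom_mod p G (c i)" and "0 < p" and "finite I" and "subgroup H G"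
    and "\<And>i. i \<in> I \<Longrightarrow> y i \<in> H"
    and "\<And>i j. i \<in> I \<Longrightarrow> j \<in> I \<Longrightarrow> [c i (y j) = of_bool (i = j)] (mod int p)"
  shows "\<exists>h\<in>H. \<forall>i\<in>I. [c i h = e i] (mod int p)"
proof -
  interpret subgroup H G by fact
  have "\<exists>h\<in>H. \<forall>i\<in>J. [c i h = e i] (mod int p)" if "finite J" "J \<subseteq> I" for J
    using that
  proof (induction J rule: finite_induct)
    case empty
    show ?case using one_closed by blast
  next
    case (insert j J)
    then obtain h where h: "h \<in> H" "\<And>i. i \<in> J \<Longrightarrow> [c i h = e i] (mod int p)" by auto
    define n where "n = nat ((e j - c j h) mod int p)"
    have n: "int n = (e j - c j h) mod int p" using assms(2) by (simp add: n_def)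
    have yj: "y j \<in> H" using insert.prems assms(5) by auto
    have step: "[c i (h \<otimes> y j [^] n) = c i h + int n * of_bool (i = j)] (mod int p)"
      if i: "i \<in> insert j J" for i
    proof -
      have hm: "hom_mod p G (c i)" and d: "[c i (y j) = of_bool (i = j)] (mod int p)"
        using i insert.prems assms(1)[of i] assms(6)[of i j] by blast+
      have "[c i (h \<otimes> y j [^] n) = c i h + c i (y j [^] n)] (mod int p)"
        using hom_mod_mult[OF hm] h(1) yj by simp
      also have "[c i h + c i (y j [^] n) = c i h + int n * c i (y j)] (mod int p)"
        using hom_mod_pow[OF hm, of "y j" n] yj by (simp add: cong_add_lcancel)
      also have "[c i h + int n * c i (y j) = c i h + int n * of_bool (i = j)] (mod int p)"
        using d by (simp add: cong_add_lcancel cong_scalar_left)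
      finally show ?thesis .
    qed
    have "[c i (h \<otimes> y j [^] n) = e i] (mod int p)" if i: "i \<in> insert j J" for i
    proof (cases "i = j")
      case True
      have "[c j h + int n = c j h + (e j - c j h)] (mod int p)"
        unfolding cong_add_lcancel n by (simp add: cong_def)
      then show ?thesis
        using cong_trans[OF step[OF i]] True by simp
    next
      case False
      then show ?thesis
        using cong_trans[OF step[OF i]] h(2)[of i] i by simp
    qed
    moreover have "y j [^] n \<in> H"
      using subgroup_int_pow_closed[OF assms(4) yj, of "int n"] by (simp add: int_pow_int)
    ultimately show ?case using h(1) by (intro bexI[of _ "h \<otimes> y j [^] n"]) auto
  qed
  then show ?thesis using assms(3) by blast
qed

lemma proper_subgroup_le_maximal:
  assumes "finite (carrier G)" and "subgroup H G" and "H \<noteq> carrier G"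
  shows "\<exists>M. maximal_subgroup M G \<and> H \<subseteq> M"
proof -
  define \<K> where "\<K> = {K. subgroup K G \<and> K \<noteq> carrier G \<and> H \<subseteq> K}"
  have "\<K> \<subseteq> Pow (carrier G)" by (auto simp: \<K>_def dest: subgroup.subset)
  then have "finite \<K>" using assms(1) finite_subset by blast
  moreover have "H \<in> \<K>" using assms(2,3) by (simp add: \<K>_def)
  ultimately obtain M where M: "M \<in> \<K>" "H \<subseteq> M" "\<And>K. K \<in> \<K> \<Longrightarrow> M \<subseteq> K \<Longrightarrow> K = M"
    using finite_has_maximal2[of \<K> H] by metis
  then have "maximal_subgroup M G"
    unfolding maximal_subgroup_def \<K>_def by (metis (mono_tags, lifting) mem_Collect_eq subset_trans)
  with M(2) show ?thesis by blast
qed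

end

text \<open>Coordinates on \<open>G/\<Phi>(G)\<close> as a vector space over the field with \<open>p\<close> elements,
  with \<open>base\<close> lifting the dual basis.\<close>

locale frattini_coordinates = group +
  fixes p k :: nat and c :: "nat \<Rightarrow> 'a \<Rightarrow> int" and base :: "nat \<Rightarrow> 'a"
  assumes prime: "Factorial_Ring.prime p"
    and finite_carrier: "finite (carrier G)"
    and coord: "\<And>i. i < k \<Longrightarrow> hom_mod p G (c i)"
    and base_closed: "\<And>i. i < k \<Longrightarrow> base i \<in> carrier G"
    and dual: "\<And>i j. i < k \<Longrightarrow> j < k \<Longrightarrow> [c i (base j) = of_bool (i = j)] (mod int p)"
    and frattini_iff: "\<And>x. x \<in> carrier G \<Longrightarrow> x \<in> frattini G \<longleftrightarrow> (\<forall>i<k. int p dvd c i x)"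

text \<open>Take a smallest family of maximal subgroups with intersection \<Phi>(G). By minimality
  each member \<open>M\<close> omits some element that all other members contain, and a suitable
  power of it has coordinate 1 at \<open>M\<close>. These powers form the dual basis.\<close>

lemma (in group) ex_frattini_coordinates:
  assumes "Factorial_Ring.prime p" and "order G = p ^ n"
  shows "\<exists>k c y. frattini_coordinates G p k c y"
proof -
  have fin: "finite (carrier G)"
    using assms order_gt_0_iff_finite prime_gt_0_nat by auto
  define \<M> where "\<M> = {M. maximal_subgroup M G}"
  have "\<M> \<subseteq> Pow (carrier G)"
    by (auto simp: \<M>_def maximal_subgroup_def dest: subgroup.subset)
  then have "finite \<M>" using fin finite_subset by blast
  define P where "P S \<longleftrightarrow> S \<subseteq> \<M> \<and> carrier G \<inter> \<Inter>S = frattini G" for S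
  have "P \<M>" by (simp add: P_def \<M>_def frattini_def)
  then obtain S where S: "P S" "\<And>T. P T \<Longrightarrow> card S \<le> card T"
    using ex_has_least_nat[of P \<M> card] by blast
  have finS: "finite S" using S(1) \<open>finite \<M>\<close> finite_subset by (auto simp: P_def)
  have maxS: "maximal_subgroup M G" if "M \<in> S" for M
    using S(1) that by (auto simp: P_def \<M>_def)
  have "\<exists>d. \<forall>M\<in>S. hom_mod p G (d M) \<and> (\<forall>x\<in>carrier G. x \<in> M \<longleftrightarrow> int p dvd d M x)"
    using maximal_subgroup_coordinate[OF assms maxS] unfolding hom_mod_def by (intro bchoice) blast
  then obtain d where d: "\<And>M. M \<in> S \<Longrightarrow> hom_mod p G (d M)"
    "\<And>M x. M \<in> S \<Longrightarrow> x \<in> carrier G \<Longrightarrow> x \<in> M \<longleftrightarrow> int p dvd d M x" by blast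
  have "\<exists>x. x \<in> carrier G \<and> [d M x = 1] (mod int p) \<and> (\<forall>N\<in>S. N \<noteq> M \<longrightarrow> x \<in> N)"
    if M: "M \<in> S" for M
  proof -
    have "card (S - {M}) < card S" using finS M by (rule card_Diff1_less)
    then have "\<not> P (S - {M})" using S(2) by (meson not_less)
    then obtain x where x: "x \<in> carrier G" "\<And>N. N \<in> S \<Longrightarrow> N \<noteq> M \<Longrightarrow> x \<in> N" "x \<notin> M"
      using S(1) unfolding P_def by blast
    then have "\<not> int p dvd d M x" using d(2) M by blast
    then have "coprime (d M x) (int p)"
      using assms(1) by (metis coprime_commute prime_imp_coprime prime_nat_int_transfer)
    \<comment> \<open>Raising \<open>x\<close> to an inverse of its coordinate modulo
      \<open>p\<close> normalizes that coordinate to 1; \<open>v\<close> is a nonnegative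
      representative of this inverse.\<close>
    then obtain u where u: "[d M x * u = 1] (mod int p)" by (meson cong_solve_coprime_int)
    define v where "v = nat (u mod int p)"
    have v: "int v = u mod int p" using prime_gt_0_nat[OF assms(1)] by (simp add: v_def)
    have "[d M (x [^] v) = int v * d M x] (mod int p)"
      using hom_mod_pow[OF d(1)[OF M] x(1)] .
    also have "[int v * d M x = d M x * u] (mod int p)"
      unfolding v by (simp add: cong_def mult.commute mod_simps)
    finally have "[d M (x [^] v) = 1] (mod int p)" using u cong_trans by blast
    moreover have "x [^] v \<in> N" if N: "N \<in> S" "N \<noteq> M" for N
      using x(2)[OF N] maxS[OF N(1)] subgroup_int_pow_closed[of N x "int v"]
      by (simp add: maximal_subgroup_def int_pow_int)
    ultimately show ?thesis using x(1) by blast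
  qed
  then have "\<exists>z. \<forall>M\<in>S. z M \<in> carrier G \<and> [d M (z M) = 1] (mod int p)
    \<and> (\<forall>N\<in>S. N \<noteq> M \<longrightarrow> z M \<in> N)"
    by (intro bchoice) blast
  then obtain z where "\<forall>M\<in>S. z M \<in> carrier G \<and> [d M (z M) = 1] (mod int p)
    \<and> (\<forall>N\<in>S. N \<noteq> M \<longrightarrow> z M \<in> N)" ..
  then have z: "\<And>M. M \<in> S \<Longrightarrow> z M \<in> carrier G"
    "\<And>M. M \<in> S \<Longrightarrow> [d M (z M) = 1] (mod int p)"
    "\<And>M N. M \<in> S \<Longrightarrow> N \<in> S \<Longrightarrow> N \<noteq> M \<Longrightarrow> z M \<in> N" by simp_all
  obtain h where "bij_betw h {0..<card S} S"
    using ex_bij_betw_nat_finite[OF finS] by blast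
  then have h: "inj_on h {..<card S}" "h ` {..<card S} = S"
    by (simp_all add: bij_betw_def lessThan_atLeast0)
  have hS: "h i \<in> S" if "i < card S" for i using h(2) that by blast
  have "frattini_coordinates G p (card S) (\<lambda>i. d (h i)) (\<lambda>i. z (h i))"
  proof
    fix i j assume ij: "i < card S" "j < card S"
    show "[d (h i) (z (h j)) = of_bool (i = j)] (mod int p)"
    proof (cases "i = j")
      case True
      then show ?thesis using z(2) hS ij by simp
    next
      case False
      then have "h i \<noteq> h j" using h(1) ij by (auto dest: inj_onD)
      then have "int p dvd d (h i) (z (h j))"
        using z(3)[OF hS[OF ij(2)] hS[OF ij(1)]] d(2)[OF hS[OF ij(1)] z(1)[OF hS[OF ij(2)]]] by simp
      then show ?thesis using False by (simp add: cong_0_iff)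
    qed
  next
    fix x assume x: "x \<in> carrier G"
    have "x \<in> frattini G \<longleftrightarrow> (\<forall>M\<in>S. x \<in> M)"
      using S(1) x unfolding P_def by blast
    also have "\<dots> \<longleftrightarrow> (\<forall>M\<in>h ` {..<card S}. int p dvd d M x)"
      using d(2) x h(2) by simp
    finally show "x \<in> frattini G \<longleftrightarrow> (\<forall>i<card S. int p dvd d (h i) x)"
      by auto
  qed (use assms fin d(1) z(1) hS in auto)
  then show ?thesis by blast
qed

context frattini_coordinates
begin

lemma realize:
  assumes "subgroup H G" and "\<And>i. i < k \<Longrightarrow> base i \<in> H"
  shows "\<exists>h\<in>H. \<forall>i<k. [c i h = e i] (mod int p)"
proof -
  have "\<exists>h\<in>H. \<forall>i\<in>{..<k}. [c i h = e i] (mod int p)"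
    using coord assms dual prime_gt_0_nat[OF prime] by (intro hom_mod_realize[where y = base]) auto
  then show ?thesis by auto
qed

text \<open>The elements \<open>base i\<close> generate \<open>G\<close>. Otherwise they lie in some
  maximal subgroup; it also contains \<Phi>(G), and every element of \<open>G\<close> is a product
  of an element generated by the \<open>base i\<close> and one of \<Phi>(G).\<close>

lemma min_gens_le: "min_gens G \<le> k"
proof -
  define H where "H = generate G (base ` {..<k})"
  have base_G: "base ` {..<k} \<subseteq> carrier G" using base_closed by auto
  have H: "subgroup H G" unfolding H_def using base_G by (rule generate_is_subgroup)
  have base_H: "base i \<in> H" if "i < k" for i
    unfolding H_def using that by (intro generate.incl) auto
  have "H = carrier G"
  proof (rule ccontr)
    assume "H \<noteq> carrier G"
    then obtain M where M: "maximal_subgroup M G" "H \<subseteq> M"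
      using proper_subgroup_le_maximal finite_carrier H by blast
    interpret M: subgroup M G using M(1) unfolding maximal_subgroup_def by blast
    have "g \<in> M" if g: "g \<in> carrier G" for g
    proof -
      obtain h where h: "h \<in> H" "\<And>i. i < k \<Longrightarrow> [c i h = c i g] (mod int p)"
        using realize[OF H base_H, of "\<lambda>i. c i g"] by blast
      have hG: "h \<in> carrier G" using h(1) M(2) by auto
      define x where "x = inv h \<otimes> g"
      have x: "x \<in> carrier G" and g_eq: "h \<otimes> x = g"
        using hG g by (auto simp: x_def inv_cancel_left)
      have "int p dvd c i x" if i: "i < k" for i
      proof -
        have "[c i g = c i h + c i x] (mod int p)"
          using hom_mod_mult[OF coord[OF i] hG x] g_eq by simp
        then have "[c i h + 0 = c i h + c i x] (mod int p)"
          using cong_trans[OF h(2)[OF i]] by simp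
        then show ?thesis
          unfolding cong_add_lcancel cong_0_iff[symmetric] by (rule cong_sym)
      qed
      then have "x \<in> frattini G" using frattini_iff x by blast
      then have "x \<in> M" using M(1) by (auto simp: frattini_def)
      then show "g \<in> M" using g_eq h(1) M(2) M.m_closed by blast
    qed
    then show False using M(1) M.subset unfolding maximal_subgroup_def by blast
  qed
  then have "min_gens G \<le> card (base ` {..<k})"
    unfolding min_gens_def using base_G by (intro Least_le) (auto simp: H_def)
  also have "\<dots> \<le> k" using card_image_le[of "{..<k}" base] by simp
  finally show ?thesis .
qed

end

section \<open>Counting in abelian p-groups\<close>

text \<open>The pigeonhole principle, with \<open>b\<close> a point whose fibre is largest.\<close>

lemma card_le_card_times_fibre:
  assumes "finite A" and "finite B" and "B \<noteq> {}" and "f ` A \<subseteq> B"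
  shows "\<exists>b\<in>B. card A \<le> card B * card {x \<in> A. f x = b}"
proof -
  define m where "m = Max ((\<lambda>b. card {x \<in> A. f x = b}) ` B)"
  have "m \<in> (\<lambda>b. card {x \<in> A. f x = b}) ` B"
    unfolding m_def using assms(2,3) by (intro Max_in) auto
  then obtain b where b: "b \<in> B" "m = card {x \<in> A. f x = b}" by auto
  have "card A = (\<Sum>b\<in>B. card {x \<in> A. f x = b})"
    using sum.group[OF assms(1,2,4), of "\<lambda>_. 1 :: nat"] by simp
  also have "\<dots> \<le> (\<Sum>b\<in>B. m)"
    using assms(2) by (intro sum_mono) (simp add: m_def)
  finally show ?thesis using b by auto
qed

text \<open>With \<open>P\<close> the set of \<open>p\<close>-th powers, some fibre of the power map
  has at least |G|/|P| elements, and dividing by one of its members moves it into the torsion set.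
  It remains to see that |G|/|P| is at least \<open>p ^ k\<close>, because \<open>p\<close>-th
  powers have zero coordinates modulo \<open>p\<close>.\<close>

lemma (in comm_group) prime_power_min_gens_le_card_torsion:
  fixes p :: nat
  assumes "Factorial_Ring.prime p" and "order G = p ^ n"
  shows "p ^ min_gens G \<le> card {z \<in> carrier G. z [^] p = \<one>}"
proof -
  obtain k c y where "frattini_coordinates G p k c y"
    using ex_frattini_coordinates[OF assms] by blast
  then interpret frattini_coordinates G p k c y .
  have p: "0 < p" using prime_gt_0_nat[OF prime] .
  define P where "P = (\<lambda>z. z [^] p) ` carrier G"
  have finP: "finite P" using finite_carrier by (simp add: P_def)
  have P_ne: "P \<noteq> {}" using one_closed unfolding P_def by blast
  define E where "E = {..<k} \<rightarrow>\<^sub>E {0..<int p}"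
  have "\<exists>h. \<forall>e\<in>E. h e \<in> carrier G \<and> (\<forall>i<k. [c i (h e) = e i] (mod int p))"
    using realize[OF subgroup_self base_closed] by (intro bchoice) blast
  then obtain h where h: "\<And>e. e \<in> E \<Longrightarrow> h e \<in> carrier G"
    "\<And>e i. e \<in> E \<Longrightarrow> i < k \<Longrightarrow> [c i (h e) = e i] (mod int p)" by blast
  have val: "[c i (h e \<otimes> z [^] p) = e i] (mod int p)"
    if "e \<in> E" "z \<in> carrier G" "i < k" for e z i
  proof -
    have "[c i (h e \<otimes> z [^] p) = c i (h e) + c i (z [^] p)] (mod int p)"
      using hom_mod_mult coord h(1) that by simp
    also have "[c i (h e) + c i (z [^] p) = e i + int p * c i z] (mod int p)"
      using h(2) hom_mod_pow coord that by (intro cong_add) auto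
    also have "[e i + int p * c i z = e i] (mod int p)"
      by (simp add: cong_def)
    finally show ?thesis .
  qed
  \<comment> \<open>The coordinates of \<open>h e \<otimes> s\<close> modulo \<open>p\<close>
    recover the reduced vector \<open>e\<close>; cancelling \<open>h e\<close> then recovers
    \<open>s\<close>.\<close>
  have "inj_on (\<lambda>(e, s). h e \<otimes> s) (E \<times> P)"
  proof (intro inj_onI, clarify)
    fix e s e' s' assume in_EP: "e \<in> E" "s \<in> P" "e' \<in> E" "s' \<in> P"
      and eq: "h e \<otimes> s = h e' \<otimes> s'"
    obtain z z' where z: "z \<in> carrier G" "s = z [^] p" "z' \<in> carrier G" "s' = z' [^] p"
      using in_EP by (auto simp: P_def)
    have "e i = e' i" for i
    proof (cases "i < k")
      case True
      have "[e i = e' i] (mod int p)"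
        using val[of e z i] val[of e' z' i] True in_EP z eq by (metis cong_sym cong_trans)
      moreover have "e i \<in> {0..<int p}" "e' i \<in> {0..<int p}"
        using in_EP(1,3) True unfolding E_def by (meson PiE_mem lessThan_iff)+
      ultimately show ?thesis by (simp add: cong_def)
    next
      case False
      then show ?thesis
        using in_EP(1,3) unfolding E_def by (metis PiE_arb lessThan_iff)
    qed
    then have "e = e'" by blast
    then show "e = e' \<and> s = s'" using eq h(1) in_EP z by simp
  qed
  moreover have "(\<lambda>(e, s). h e \<otimes> s) ` (E \<times> P) \<subseteq> carrier G"
    using h(1) by (auto simp: P_def)
  ultimately have "card (E \<times> P) \<le> card (carrier G)"
    using finite_carrier by (intro card_inj_on_le)
  then have le: "card P * p ^ k \<le> card (carrier G)"
    by (simp add: E_def card_cartesian_product card_PiE mult.commute)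
  obtain b where b: "b \<in> P" "card (carrier G) \<le> card P * card {z \<in> carrier G. z [^] p = b}"
    using card_le_card_times_fibre[OF finite_carrier finP P_ne, of "\<lambda>z. z [^] p"]
    by (auto simp: P_def)
  obtain z0 where z0: "z0 \<in> carrier G" "b = z0 [^] p" using b(1) by (auto simp: P_def)
  have "inj_on (\<lambda>z. z \<otimes> inv z0) {z \<in> carrier G. z [^] p = b}"
    using inj_on_multc[OF inv_closed[OF z0(1)]] by (rule inj_on_subset) blast
  moreover have "(z \<otimes> inv z0) [^] p = \<one>" if "z \<in> carrier G" "z [^] p = b" for z
    using that z0 by (simp add: nat_pow_distrib nat_pow_inv)
  then have "(\<lambda>z. z \<otimes> inv z0) ` {z \<in> carrier G. z [^] p = b} \<subseteq> {z \<in> carrier G. z [^] p = \<one>}"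
    using z0(1) by blast
  ultimately have "card {z \<in> carrier G. z [^] p = b} \<le> card {z \<in> carrier G. z [^] p = \<one>}"
    using finite_carrier by (intro card_inj_on_le) auto
  then have "card P * p ^ k \<le> card P * card {z \<in> carrier G. z [^] p = \<one>}"
    using le b(2) by (meson le_trans mult_le_mono2)
  then have "p ^ k \<le> card {z \<in> carrier G. z [^] p = \<one>}"
    using finP P_ne by (simp add: card_gt_0_iff)
  moreover have "p ^ min_gens G \<le> p ^ k"
    using min_gens_le p by (simp add: power_increasing)
  ultimately show ?thesis by linarith
qed

text \<open>A further generator \<open>x\<close> contributes at most the \<open>p\<close> powers of
  \<open>x\<close> as new factors.\<close>

lemma (in comm_group) card_generate_le:
  assumes "finite S" and "S \<subseteq> carrier G" and "0 < p" and "\<And>x. x \<in> S \<Longrightarrow> x [^] (p :: nat) = \<one>"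
  shows "finite (generate G S) \<and> card (generate G S) \<le> p ^ card S"
  using assms(1,2,4)
proof (induction S rule: finite_induct)
  case empty
  have "generate G {} = {\<one>}"
    by (metis empty_subsetI generate_empty)
  then show ?case by simp
next
  case (insert x S)
  define K where "K = generate G {x} <#> generate G S"
  have x: "x \<in> carrier G" and S: "S \<subseteq> carrier G" using insert.prems by auto
  have sub: "subgroup (generate G {x}) G" "subgroup (generate G S) G"
    using x S by (auto intro: generate_is_subgroup)
  have "\<exists>e<p. g = x [^] e" if g: "g \<in> generate G {x}" for g
  proof -
    obtain a :: int where a: "g = x [^] a" using g unfolding generate_pow[OF x] by blast
    have "g = x [^] (int p * (a div int p) + a mod int p)"
      using a by simp
    also have "\<dots> = (x [^] int p) [^] (a div int p) \<otimes> x [^] (a mod int p)"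
      unfolding int_pow_pow[OF x] by (rule int_pow_mult[OF x])
    also have "\<dots> = x [^] nat (a mod int p)"
      using insert.prems(2)[of x] x assms(3) int_pow_int[of G x "nat (a mod int p)"]
      by (simp add: int_pow_int)
    finally show ?thesis using assms(3)
      by (intro exI[of _ "nat (a mod int p)"]) (simp add: nat_less_iff)
  qed
  then have K: "K \<subseteq> (\<lambda>(e, s). x [^] e \<otimes> s) ` ({..<p} \<times> generate G S)"
    unfolding K_def set_mult_def by fastforce
  have IH: "finite (generate G S)" "card (generate G S) \<le> p ^ card S"
    using insert.IH[OF S] insert.prems(2) by auto
  have finK: "finite K" using K IH(1) by (meson finite_SigmaI finite_imageI finite_lessThan finite_subset)
  have "card K \<le> card ({..<p} \<times> generate G S)"
    using K IH(1) by (meson surj_card_le finite_SigmaI finite_lessThan)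
  also have "\<dots> \<le> p * p ^ card S"
    using IH(2) by (simp add: card_cartesian_product)
  finally have cardK: "card K \<le> p ^ card (insert x S)"
    using insert.hyps by simp
  have "insert x S \<subseteq> K"
  proof
    fix g assume g: "g \<in> insert x S"
    have "x \<in> generate G {x}" "\<one> \<in> generate G {x}" "\<one> \<in> generate G S"
      by (auto intro: generate.incl generate.one)
    moreover have "g = x \<otimes> \<one> \<or> g \<in> S \<and> g = \<one> \<otimes> g" using g x S by auto
    ultimately show "g \<in> K" unfolding K_def set_mult_def
      using generate.incl[of g S G] by blast
  qed
  then have "generate G (insert x S) \<subseteq> K"
    using mult_subgroups[OF sub] unfolding K_def by (intro generate_subgroup_incl)
  then show ?case
    using finK cardK by (meson card_mono finite_subset le_trans)
qed

lemma (in group) card_elementary_abelian_le: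
  fixes p :: nat
  assumes "finite (carrier G)" and "subgroup K G" and "0 < p"
    and "\<And>x y. x \<in> K \<Longrightarrow> y \<in> K \<Longrightarrow> x \<otimes> y = y \<otimes> x"
    and "\<And>x. x \<in> K \<Longrightarrow> x [^] p = \<one>"
  shows "card K \<le> p ^ group_rank G"
proof -
  interpret K: subgroup K G by fact
  have "\<forall>L. subgroup L G \<longrightarrow>
      (\<exists>S. S \<subseteq> L \<and> finite S \<and> card S \<le> group_rank G \<and> generate G S = L)"
    unfolding group_rank_def
  proof (rule LeastI)
    \<comment> \<open>The least bound in \<open>group_rank\<close> exists because the order of
      \<open>G\<close> is one: every subgroup is generated by all of its elements.\<close>
    show "\<forall>L. subgroup L G \<longrightarrow>
      (\<exists>S. S \<subseteq> L \<and> finite S \<and> card S \<le> card (carrier G) \<and> generate G S = L)"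
    proof (intro allI impI)
      fix L assume L: "subgroup L G"
      then have "finite L" "card L \<le> card (carrier G)"
        using assms(1) by (auto intro: card_mono finite_subset dest: subgroup.subset)
      moreover have "generate G L = L"
        using generateI[OF L, of L] by blast
      ultimately show "\<exists>S. S \<subseteq> L \<and> finite S \<and> card S \<le> card (carrier G) \<and> generate G S = L"
        by blast
    qed
  qed
  then obtain S where S: "S \<subseteq> K" "finite S" "card S \<le> group_rank G" "generate G S = K"
    using assms(2) by blast
  interpret GK: comm_group "G\<lparr>carrier := K\<rparr>"
    using assms(4) by (intro group.group_comm_groupI subgroup_imp_group[OF assms(2)]) auto
  have "card (generate (G\<lparr>carrier := K\<rparr>) S) \<le> p ^ card S"
    using GK.card_generate_le[of S p] S(1,2) assms(3,5)
    by (auto simp flip: nat_pow_consistent)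
  then have "card K \<le> p ^ card S"
    using generate_consistent[OF S(1) assms(2)] S(4) by simp
  also have "\<dots> \<le> p ^ group_rank G" using S(3) assms(3) by (simp add: power_increasing)
  finally show ?thesis .
qed

section \<open>Products of powers\<close>

text \<open>An integer linear combination of the \<open>w i\<close> with coefficients
  \<open>e i\<close>, in multiplicative notation.\<close>

definition pow_prod :: "('a, 'b) monoid_scheme \<Rightarrow> ('i \<Rightarrow> 'a) \<Rightarrow> 'i set \<Rightarrow> ('i \<Rightarrow> int) \<Rightarrow> 'a" where
  "pow_prod G w I e = finprod G (\<lambda>i. w i [^]\<^bsub>G\<^esub> e i) I"

context comm_group
begin

lemma pow_prod_closed [simp]:
  "(\<And>i. i \<in> I \<Longrightarrow> w i \<in> carrier G) \<Longrightarrow> pow_prod G w I e \<in> carrier G"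
  unfolding pow_prod_def by (rule finprod_closed) simp

lemma pow_prod_empty [simp]: "pow_prod G w {} e = \<one>"
  by (simp add: pow_prod_def)

lemma pow_prod_insert:
  assumes "finite I" and "j \<notin> I" and "w j \<in> carrier G" and "\<And>i. i \<in> I \<Longrightarrow> w i \<in> carrier G"
  shows "pow_prod G w (insert j I) e = w j [^] e j \<otimes> pow_prod G w I e"
  unfolding pow_prod_def using assms by (intro finprod_insert) auto

lemma pow_prod_add:
  assumes "\<And>i. i \<in> I \<Longrightarrow> w i \<in> carrier G"
  shows "pow_prod G w I (\<lambda>i. e i + e' i) = pow_prod G w I e \<otimes> pow_prod G w I e'"
proof -
  have "pow_prod G w I (\<lambda>i. e i + e' i) = finprod G (\<lambda>i. w i [^] e i \<otimes> w i [^] e' i) I"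
    unfolding pow_prod_def using assms by (intro finprod_cong') (auto simp: int_pow_mult)
  also have "\<dots> = pow_prod G w I e \<otimes> pow_prod G w I e'"
    unfolding pow_prod_def using assms by (intro finprod_multf) auto
  finally show ?thesis .
qed

lemma pow_prod_scale:
  fixes n :: int
  assumes "finite I" and "\<And>i. i \<in> I \<Longrightarrow> w i \<in> carrier G"
  shows "pow_prod G w I (\<lambda>i. n * e i) = pow_prod G w I e [^] n"
  using assms
proof (induction I rule: finite_induct)
  case (insert j I)
  have "w j \<in> carrier G" "pow_prod G w I e \<in> carrier G" using insert.prems by auto
  moreover have "w j [^] (n * e j) = (w j [^] e j) [^] n"
    using insert.prems by (simp add: int_pow_pow mult.commute)
  ultimately show ?case
    using insert by (simp add: pow_prod_insert int_pow_distrib)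
qed simp

text \<open>This is what makes coordinates usable as exponents, since they are additive only modulo
  \<open>p\<close>.\<close>

lemma pow_prod_cong:
  fixes p :: nat
  assumes "\<And>i. i \<in> I \<Longrightarrow> w i \<in> carrier G" and "\<And>i. i \<in> I \<Longrightarrow> w i [^] p = \<one>"
    and "\<And>i. i \<in> I \<Longrightarrow> [e i = e' i] (mod int p)"
  shows "pow_prod G w I e = pow_prod G w I e'"
  unfolding pow_prod_def
proof (rule finprod_cong')
  fix i assume i: "i \<in> I"
  have w: "w i \<in> carrier G" using assms(1)[OF i] .
  obtain r where r: "e i = e' i + int p * r"
    using assms(3)[OF i] by (metis cong_iff_lin cong_sym)
  have "w i [^] e i = w i [^] e' i \<otimes> (w i [^] int p) [^] r"
    unfolding r int_pow_pow[OF w] by (rule int_pow_mult[OF w])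
  then show "w i [^] e i = w i [^] e' i"
    using assms(2)[OF i] w by (simp add: int_pow_int)
qed (use assms(1) in auto)

lemma pow_prod_zero: "pow_prod G w I (\<lambda>i. 0) = \<one>"
  by (simp add: pow_prod_def)

lemma pow_prod_torsion:
  fixes p :: nat
  assumes "finite I" and "\<And>i. i \<in> I \<Longrightarrow> w i \<in> carrier G" and "\<And>i. i \<in> I \<Longrightarrow> w i [^] p = \<one>"
  shows "pow_prod G w I e [^] p = \<one>"
proof -
  have "pow_prod G w I e [^] int p = pow_prod G w I (\<lambda>i. int p * e i)"
    using pow_prod_scale[OF assms(1,2)] by simp
  also have "\<dots> = pow_prod G w I (\<lambda>i. 0)"
    using assms(2,3) by (rule pow_prod_cong) (auto simp: cong_0_iff)
  also have "\<dots> = \<one>" by (rule pow_prod_zero)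
  finally show ?thesis by (simp add: int_pow_int)
qed

lemma pow_prod_single:
  fixes p :: nat
  assumes "finite I" and "j \<in> I" and "\<And>i. i \<in> I \<Longrightarrow> w i \<in> carrier G"
    and "\<And>i. i \<in> I \<Longrightarrow> w i [^] p = \<one>" and "\<And>i. i \<in> I \<Longrightarrow> [e i = of_bool (i = j)] (mod int p)"
  shows "pow_prod G w I e = w j"
proof -
  have "pow_prod G w I e = pow_prod G w I (\<lambda>i. of_bool (i = j))"
    using assms(3-5) by (rule pow_prod_cong)
  also have "\<dots> = finprod G (\<lambda>i. if i = j then w i else \<one>) I"
    unfolding pow_prod_def using assms(3) by (intro finprod_cong') auto
  also have "\<dots> = w j"
    using finprod_singleton_swap[OF assms(2,1), of w] assms(3) by simp
  finally show ?thesis .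
qed

lemma pow_prod_div:
  assumes "finite I" and "\<And>i. i \<in> I \<Longrightarrow> w i \<in> carrier G" and "\<And>i. i \<in> I \<Longrightarrow> u i \<in> carrier G"
  shows "pow_prod G (\<lambda>i. w i \<otimes> inv (u i)) I e = pow_prod G w I e \<otimes> inv (pow_prod G u I e)"
proof -
  have "pow_prod G (\<lambda>i. w i \<otimes> inv (u i)) I e = finprod G (\<lambda>i. w i [^] e i \<otimes> u i [^] (- 1 * e i)) I"
    unfolding pow_prod_def using assms(2,3)
    by (intro finprod_cong') (auto simp: int_pow_distrib int_pow_inv int_pow_neg)
  also have "\<dots> = pow_prod G w I e \<otimes> pow_prod G u I (\<lambda>i. - 1 * e i)"
    unfolding pow_prod_def using assms(2,3) by (intro finprod_multf) auto
  also have "pow_prod G u I (\<lambda>i. - 1 * e i) = inv (pow_prod G u I e)"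
    using pow_prod_scale[OF assms(1,3), where n = "- 1" and e = e] assms(3) by (simp add: int_pow_neg)
  finally show ?thesis .
qed

text \<open>Composition of linear combinations, with coefficients multiplied as matrices. It later
  assembles the commutators with the single \<open>v i\<close> into one bilinear expression.\<close>

lemma pow_prod_pow_prod:
  assumes "finite I" and "finite J" and "\<And>i. i \<in> I \<Longrightarrow> w i \<in> carrier G"
  shows "pow_prod G (\<lambda>j. pow_prod G w I (m j)) J e = pow_prod G w I (\<lambda>i. \<Sum>j\<in>J. e j * m j i)"
  using assms(2)
proof (induction J rule: finite_induct)
  case empty
  show ?case by (simp add: pow_prod_zero)
next
  case (insert j J)
  have "pow_prod G (\<lambda>j. pow_prod G w I (m j)) (insert j J) e =
      pow_prod G w I (\<lambda>i. e j * m j i) \<otimes> pow_prod G w I (\<lambda>i. \<Sum>j\<in>J. e j * m j i)"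
    using insert assms(1,3) by (simp add: pow_prod_insert pow_prod_scale)
  also have "\<dots> = pow_prod G w I (\<lambda>i. e j * m j i + (\<Sum>j\<in>J. e j * m j i))"
    using assms(3) by (simp add: pow_prod_add)
  finally show ?case using insert.hyps by simp
qed

lemma pow_prod_in_subgroup:
  assumes "subgroup H G" and "finite I" and "\<And>i. i \<in> I \<Longrightarrow> w i \<in> H"
  shows "pow_prod G w I e \<in> H"
  using assms(2,3)
proof (induction I rule: finite_induct)
  case empty
  show ?case using assms(1) by (simp add: subgroup.one_closed)
next
  case (insert j I)
  have "w j [^] e j \<in> H" using subgroup_int_pow_closed[OF assms(1)] insert.prems by simp
  moreover have "\<And>i. i \<in> insert j I \<Longrightarrow> w i \<in> carrier G"
    using insert.prems assms(1) subgroup.mem_carrier by metis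
  ultimately show ?case
    using insert assms(1) by (simp add: pow_prod_insert subgroup.m_closed)
qed

end

section \<open>Cocycles and the automorphisms they induce\<close>

lemma (in group) center_iff: "z \<in> center G \<longleftrightarrow> z \<in> carrier G \<and> (\<forall>x\<in>carrier G. z \<otimes> x = x \<otimes> z)"
  by (simp add: center_def centralizer_def)

lemma (in group) subgroup_center: "subgroup (center G) G"
proof (rule subgroupI)
  fix a b assume ab: "a \<in> center G" "b \<in> center G"
  then have G: "a \<in> carrier G" "b \<in> carrier G" unfolding center_iff by blast+
  have "a \<otimes> b \<otimes> x = x \<otimes> (a \<otimes> b)" if x: "x \<in> carrier G" for x
  proof -
    have "a \<otimes> x = x \<otimes> a" "b \<otimes> x = x \<otimes> b" using ab x unfolding center_iff by blast+
    then show ?thesis using G x by (metis m_assoc)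
  qed
  then show "a \<otimes> b \<in> center G" using G unfolding center_iff by simp
next
  fix a assume a: "a \<in> center G"
  then have G: "a \<in> carrier G" unfolding center_iff by blast
  have "inv a \<otimes> x = x \<otimes> inv a" if x: "x \<in> carrier G" for x
  proof -
    have "a \<otimes> x = x \<otimes> a" using a x unfolding center_iff by blast
    then show ?thesis using G x by (metis inv_closed inv_solve_left inv_solve_right m_assoc m_closed)
  qed
  then show "inv a \<in> center G" using G unfolding center_iff by simp
next
  have "\<one> \<in> center G" by (simp add: center_iff)
  then show "center G \<noteq> {}" by blast
qed (auto simp: center_iff)

lemma (in group) normal_center: "center G \<lhd> G"
proof -
  have "x \<otimes> h \<otimes> inv x \<in> center G" if x: "x \<in> carrier G" and h: "h \<in> center G" for x h
  proof -
    have hG: "h \<in> carrier G" and "h \<otimes> x = x \<otimes> h" using h x unfolding center_iff by blast+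
    then have "x \<otimes> h \<otimes> inv x = h"
      using x by (metis inv_closed m_assoc r_inv r_one)
    then show ?thesis using h by simp
  qed
  then show ?thesis using subgroup_center unfolding normal_inv_iff by blast
qed

lemma (in group) subgroup_frattini: "subgroup (frattini G) G"
proof -
  have "subgroup (\<Inter>(insert (carrier G) {M. maximal_subgroup M G})) G"
    by (rule subgroups_Inter) (auto simp: maximal_subgroup_def subgroup_self)
  then show ?thesis by (simp add: frattini_def)
qed

section \<open>The abelian group Z(\<Phi>(G)) and its crossed homomorphisms\<close>

locale frattini_centralizer = frattini_coordinates +
  assumes centralizer_eq: "centralizer G (center (G\<lparr>carrier := frattini G\<rparr>)) = frattini G"
begin

definition A :: "'a set" where "A = center (G\<lparr>carrier := frattini G\<rparr>)"

abbreviation GA :: "('a, 'b) monoid_scheme" where "GA \<equiv> G\<lparr>carrier := A\<rparr>"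

definition W :: "'a set" where "W = {z \<in> center G. z [^] p = \<one>}"

lemma A_iff: "a \<in> A \<longleftrightarrow> a \<in> frattini G \<and> (\<forall>x\<in>frattini G. a \<otimes> x = x \<otimes> a)"
  unfolding A_def by (simp add: group.center_iff[OF subgroup_imp_group[OF subgroup_frattini]])

lemma frattini_closed: "x \<in> frattini G \<Longrightarrow> x \<in> carrier G"
  by (simp add: frattini_def)

lemma A_closed [simp]: "a \<in> A \<Longrightarrow> a \<in> carrier G"
  unfolding A_iff by (blast intro: frattini_closed)

lemma A_comm: "a \<in> A \<Longrightarrow> b \<in> A \<Longrightarrow> a \<otimes> b = b \<otimes> a"
  unfolding A_iff by blast

lemma subgroup_A: "subgroup A G"
  using group.subgroup_center[OF subgroup_imp_group[OF subgroup_frattini]]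
    incl_subgroup[OF subgroup_frattini] unfolding A_def by blast

lemma comm_group_GA: "comm_group GA"
  using A_comm by (intro group.group_comm_groupI subgroup_imp_group[OF subgroup_A]) auto

text \<open>Such a \<open>g\<close> centralizes the subgroup \<open>A\<close> of \<Phi>(G), so the
  hypothesis on the centralizer places it in \<Phi>(G), and then in its center.\<close>

lemma centralizer_frattini_in_A:
  assumes "g \<in> carrier G" and "\<And>x. x \<in> frattini G \<Longrightarrow> g \<otimes> x = x \<otimes> g"
  shows "g \<in> A"
proof -
  have "g \<in> centralizer G A"
    using assms A_iff unfolding centralizer_def by blast
  then have "g \<in> frattini G" using centralizer_eq by (simp add: A_def)
  then show ?thesis using assms(2) unfolding A_iff by blast
qed

lemma center_sub_A: "center G \<subseteq> A"
proof
  fix z assume "z \<in> center G"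
  then have "z \<in> carrier G" "\<And>x. x \<in> carrier G \<Longrightarrow> z \<otimes> x = x \<otimes> z"
    unfolding center_iff by blast+
  then show "z \<in> A" using frattini_closed by (intro centralizer_frattini_in_A) blast+
qed

lemma W_center: "w \<in> W \<Longrightarrow> w \<in> center G"
  by (simp add: W_def)

lemma W_A: "w \<in> W \<Longrightarrow> w \<in> A"
  using W_center center_sub_A by blast

lemma nat_pow_GA [simp]: "a [^]\<^bsub>GA\<^esub> (n :: nat) = a [^] n"
  by (simp flip: nat_pow_consistent)

lemma inv_GA [simp]: "a \<in> A \<Longrightarrow> inv\<^bsub>GA\<^esub> a = inv a"
  using subgroup_A by simp

lemma A_mult [simp]: "a \<in> A \<Longrightarrow> b \<in> A \<Longrightarrow> a \<otimes> b \<in> A"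
  using subgroup_A by (simp add: subgroup.m_closed)

lemma A_inv [simp]: "a \<in> A \<Longrightarrow> inv a \<in> A"
  using subgroup_A by (simp add: subgroup.m_inv_closed)

lemma A_pow [simp]: "a \<in> A \<Longrightarrow> a [^] (n :: nat) \<in> A"
  using subgroup_int_pow_closed[OF subgroup_A, of a "int n"] by (simp add: int_pow_int)

lemma center_comm: "z \<in> center G \<Longrightarrow> x \<in> carrier G \<Longrightarrow> z \<otimes> x = x \<otimes> z"
  unfolding center_iff by blast

lemma center_conj:
  assumes "z \<in> center G" and "x \<in> carrier G"
  shows "x \<otimes> z \<otimes> inv x = z"
proof -
  have "z \<in> carrier G" and "x \<otimes> z = z \<otimes> x" using assms unfolding center_iff by auto
  then show ?thesis using assms(2) by (simp add: m_assoc)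
qed

text \<open>Crossed homomorphisms \<open>f\<close> from \<open>G/\<Phi>(G)\<close> to the elements of order dividing \<open>p\<close>
  in \<open>Z(\<Phi>(G))\<close>; such an \<open>f\<close> encodes the automorphism \<open>x \<mapsto> f x \<otimes> x\<close>.\<close>

definition cocycles :: "('a \<Rightarrow> 'a) set" where
  "cocycles = {f \<in> carrier G \<rightarrow>\<^sub>E A.
     (\<forall>x\<in>carrier G. f x [^] p = \<one>) \<and>
     (\<forall>x\<in>carrier G. \<forall>y\<in>carrier G. f (x \<otimes> y) = f x \<otimes> (x \<otimes> f y \<otimes> inv x)) \<and>
     (\<forall>x\<in>frattini G. f x = \<one>)}"

lemma cocyclesD:
  assumes "f \<in> cocycles"
  shows "x \<in> carrier G \<Longrightarrow> f x \<in> A" and "x \<in> carrier G \<Longrightarrow> f x [^] p = \<one>"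
    and "x \<in> carrier G \<Longrightarrow> y \<in> carrier G \<Longrightarrow> f (x \<otimes> y) = f x \<otimes> (x \<otimes> f y \<otimes> inv x)"
    and "x \<in> frattini G \<Longrightarrow> f x = \<one>" and "f \<in> extensional (carrier G)"
  using assms by (auto simp: cocycles_def PiE_def)

lemma finite_cocycles: "finite cocycles"
proof (rule finite_subset)
  show "cocycles \<subseteq> carrier G \<rightarrow>\<^sub>E A"
    unfolding cocycles_def by blast
  have "finite A" using finite_carrier A_closed by (meson finite_subset subsetI)
  then show "finite (carrier G \<rightarrow>\<^sub>E A)"
    using finite_carrier by (simp add: finite_PiE)
qed

text \<open>A cocycle is trivial on \<open>A\<close>, and conjugation by elements of
  \<open>A\<close> fixes its values. In particular \<open>f\<close> takes the same value at
  \<open>x\<close> and at \<open>f x \<otimes> x\<close>, which makes the induced maps easy to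
  invert and to iterate.\<close>

lemma cocycle_A_mult:
  assumes f: "f \<in> cocycles" and a: "a \<in> A" and x: "x \<in> carrier G"
  shows "f (a \<otimes> x) = f x"
proof -
  have fx: "f x \<in> A" using cocyclesD(1)[OF f x] .
  have "f (a \<otimes> x) = f a \<otimes> (a \<otimes> f x \<otimes> inv a)"
    using cocyclesD(3)[OF f _ x] a by simp
  also have "f a = \<one>" using cocyclesD(4)[OF f] a unfolding A_iff by blast
  also have "a \<otimes> f x \<otimes> inv a = f x"
    using a fx by (simp add: A_comm[OF a fx] m_assoc)
  finally show ?thesis using fx by simp
qed

definition aut_of :: "('a \<Rightarrow> 'a) \<Rightarrow> 'a \<Rightarrow> 'a" where
  "aut_of f = (\<lambda>x\<in>carrier G. f x \<otimes> x)"

text \<open>The cocycle identity gives multiplicativity. The inverse map is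
  \<open>inv (f x) \<otimes> x\<close>, because factors from \<open>A\<close> do not change the
  value of \<open>f\<close>.\<close>

lemma aut_of_auto:
  assumes f: "f \<in> cocycles"
  shows "aut_of f \<in> auto G"
proof -
  have closed: "f x \<in> A" if "x \<in> carrier G" for x using cocyclesD(1)[OF f that] .
  have fixA: "f (f x \<otimes> x) = f x" "f (inv (f x) \<otimes> x) = f x" if "x \<in> carrier G" for x
    using cocycle_A_mult[OF f _ that] closed[OF that] by simp_all
  have "aut_of f \<in> hom G G"
  proof (rule homI)
    fix x y assume xy: "x \<in> carrier G" "y \<in> carrier G"
    have "f x \<otimes> (x \<otimes> f y \<otimes> inv x) \<otimes> (x \<otimes> y) = f x \<otimes> x \<otimes> (f y \<otimes> y)"
      using xy closed by (simp add: m_assoc inv_cancel_left)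
    then show "aut_of f (x \<otimes> y) = aut_of f x \<otimes> aut_of f y"
      using xy cocyclesD(3)[OF f xy] by (simp add: aut_of_def)
  qed (use closed in \<open>simp add: aut_of_def\<close>)
  moreover have "bij_betw (aut_of f) (carrier G) (carrier G)"
  proof (rule bij_betw_byWitness[where f' = "\<lambda>x. inv (f x) \<otimes> x"])
    show "\<forall>a\<in>carrier G. inv (f (aut_of f a)) \<otimes> aut_of f a = a"
      using closed fixA by (simp add: aut_of_def inv_cancel_left)
    show "\<forall>a'\<in>carrier G. aut_of f (inv (f a') \<otimes> a') = a'"
      using closed fixA by (simp add: aut_of_def inv_cancel_left)
  qed (use closed in \<open>auto simp: aut_of_def\<close>)
  ultimately show ?thesis
    by (simp add: auto_def Bij_def aut_of_def)
qed

lemma aut_of_pow: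
  fixes n :: nat
  assumes f: "f \<in> cocycles"
  shows "aut_of f [^]\<^bsub>AutoGroup G\<^esub> n = (\<lambda>x\<in>carrier G. f x [^] n \<otimes> x)"
proof -
  interpret Aut: group "AutoGroup G" by (rule AutoGroup)
  have carrier_Aut: "carrier (AutoGroup G) = auto G" by (simp add: AutoGroup_def)
  have mult_Aut: "\<alpha> \<otimes>\<^bsub>AutoGroup G\<^esub> \<beta> = compose (carrier G) \<alpha> \<beta>"
    if "\<alpha> \<in> auto G" "\<beta> \<in> auto G" for \<alpha> \<beta>
    using that by (simp add: AutoGroup_def BijGroup_def auto_def)
  show ?thesis
  proof (induction n)
    case 0
    show ?case by (auto simp: AutoGroup_def BijGroup_def intro: restrict_ext)
  next
    case (Suc n)
    have mem: "aut_of f [^]\<^bsub>AutoGroup G\<^esub> n \<in> auto G"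
      using Aut.nat_pow_closed aut_of_auto[OF f] carrier_Aut by metis
    have "aut_of f [^]\<^bsub>AutoGroup G\<^esub> Suc n =
        compose (carrier G) (\<lambda>x\<in>carrier G. f x [^] n \<otimes> x) (aut_of f)"
      using mult_Aut[OF mem aut_of_auto[OF f]] unfolding Aut.nat_pow_Suc Suc.IH .
    also have "\<dots> = (\<lambda>x\<in>carrier G. f x [^] Suc n \<otimes> x)"
      unfolding compose_def
    proof (rule restrict_ext)
      fix x assume x: "x \<in> carrier G"
      then show "(\<lambda>x\<in>carrier G. f x [^] n \<otimes> x) (aut_of f x) = f x [^] Suc n \<otimes> x"
        using cocyclesD(1)[OF f x] cocycle_A_mult[OF f _ x, of "f x"]
        by (simp add: aut_of_def m_assoc)
    qed
    finally show ?case .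
  qed
qed

text \<open>Values of \<open>f\<close> have trivial \<open>p\<close>-th powers, so the order divides
  \<open>p\<close>; the nontrivial value excludes order 1.\<close>

lemma ord_aut_of:
  assumes f: "f \<in> cocycles" and ex: "x \<in> carrier G" "f x \<noteq> \<one>"
  shows "group.ord (AutoGroup G) (aut_of f) = p"
proof -
  interpret Aut: group "AutoGroup G" by (rule AutoGroup)
  have mem: "aut_of f \<in> carrier (AutoGroup G)"
    using aut_of_auto[OF f] by (simp add: AutoGroup_def)
  have one: "\<one>\<^bsub>AutoGroup G\<^esub> = (\<lambda>x\<in>carrier G. x)"
    by (simp add: AutoGroup_def BijGroup_def)
  have "aut_of f [^]\<^bsub>AutoGroup G\<^esub> p = \<one>\<^bsub>AutoGroup G\<^esub>"
    unfolding aut_of_pow[OF f] one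
    by (rule restrict_ext) (simp add: cocyclesD(2)[OF f])
  then have "Aut.ord (aut_of f) dvd p"
    using Aut.pow_eq_id[OF mem] by simp
  moreover have "aut_of f \<noteq> \<one>\<^bsub>AutoGroup G\<^esub>"
  proof
    assume "aut_of f = \<one>\<^bsub>AutoGroup G\<^esub>"
    then have "aut_of f x = x" using ex(1) by (simp add: one)
    then show False using ex cocyclesD(1)[OF f ex(1)] by (simp add: aut_of_def)
  qed
  then have "Aut.ord (aut_of f) \<noteq> 1"
    using Aut.ord_eq_1[OF mem] by simp
  ultimately show ?thesis using prime by (auto simp: prime_nat_iff)
qed

end

text \<open>The assumption \<open>inner\<close> is the negation of the theorem's conclusion; the
  bounds derived here are contradictory under its rank hypothesis.\<close>

locale frattini_inner = frattini_centralizer +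
  assumes inner: "\<And>\<alpha>. \<alpha> \<in> auto G \<Longrightarrow> group.ord (AutoGroup G) \<alpha> = p \<Longrightarrow>
    (\<And>x. x \<in> frattini G \<Longrightarrow> \<alpha> x = x) \<Longrightarrow> \<alpha> \<in> inner_auto G"
begin

text \<open>The automorphism of a nontrivial cocycle has order \<open>p\<close> and fixes \<Phi>(G),
  so some \<open>g\<close> induces it. This \<open>g\<close> centralizes \<Phi>(G), hence lies in
  \<open>A\<close>. The trivial cocycle gives the identity, whose order is 1, and is treated
  separately.\<close>

lemma cocycle_principal:
  assumes f: "f \<in> cocycles"
  shows "\<exists>a\<in>A. a [^] p \<in> center G \<and> (\<forall>x\<in>carrier G. f x \<otimes> x = a \<otimes> x \<otimes> inv a)"
proof (cases "\<forall>x\<in>carrier G. f x = \<one>")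
  case True
  have "\<one> \<in> center G" using subgroup_center subgroup.one_closed by blast
  moreover have "\<one> \<in> A" using calculation center_sub_A by blast
  ultimately show ?thesis using True by (intro bexI[of _ \<one>]) auto
next
  case False
  then obtain x0 where "x0 \<in> carrier G" "f x0 \<noteq> \<one>" by blast
  then have "aut_of f \<in> inner_auto G"
    using f cocyclesD(4)[OF f] frattini_closed
    by (intro inner aut_of_auto ord_aut_of) (auto simp: aut_of_def)
  then obtain g where g: "g \<in> carrier G"
    "aut_of f = (\<lambda>x\<in>carrier G. g \<otimes> x \<otimes> inv g)"
    by (auto simp: inner_auto_def)
  have eq: "f x \<otimes> x = g \<otimes> x \<otimes> inv g" if x: "x \<in> carrier G" for x
    using fun_cong[OF g(2), of x] x by (simp add: aut_of_def)
  have "g \<otimes> x = x \<otimes> g" if x: "x \<in> frattini G" for x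
  proof -
    have xG: "x \<in> carrier G" using x by (rule frattini_closed)
    have "x = g \<otimes> x \<otimes> inv g"
      using eq[OF xG] cocyclesD(4)[OF f x] xG by simp
    then show ?thesis using inv_solve_right[of x "g \<otimes> x" g] xG g(1) by simp
  qed
  then have gA: "g \<in> A" using g(1) by (intro centralizer_frattini_in_A)
  \<comment> \<open>For \<open>n = p\<close> the factor \<open>f x [^] n\<close> is trivial, so
    \<open>g [^] p\<close> is central.\<close>
  have pow: "g [^] n \<otimes> x = f x [^] n \<otimes> x \<otimes> g [^] n" if x: "x \<in> carrier G" for n :: nat and x
  proof (induction n)
    case 0
    show ?case using x by simp
  next
    case (Suc n)
    have fx: "f x \<in> A" using cocyclesD(1)[OF f x] .
    have gx: "f x \<otimes> x \<otimes> g = g \<otimes> x"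
      using eq[OF x] x g(1) by (simp add: m_assoc)
    have "g [^] Suc n \<otimes> x = g \<otimes> (g [^] n \<otimes> x)"
      using x g(1) nat_pow_Suc2[OF g(1), of n] by (simp add: m_assoc del: nat_pow_Suc)
    also have "\<dots> = g \<otimes> f x [^] n \<otimes> x \<otimes> g [^] n"
      using Suc.IH x g(1) fx by (simp add: m_assoc)
    also have "g \<otimes> f x [^] n = f x [^] n \<otimes> g"
      using gA fx by (intro A_comm) auto
    also have "f x [^] n \<otimes> g \<otimes> x \<otimes> g [^] n = f x [^] n \<otimes> (f x \<otimes> x \<otimes> g) \<otimes> g [^] n"
      using gx x g(1) fx by (simp add: m_assoc)
    also have "\<dots> = f x [^] Suc n \<otimes> x \<otimes> (g \<otimes> g [^] n)"
      using x g(1) fx by (simp add: m_assoc)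
    also have "g \<otimes> g [^] n = g [^] Suc n"
      using nat_pow_Suc2[OF g(1)] by simp
    finally show ?case .
  qed
  have "g [^] p \<in> center G"
    unfolding center_iff using pow[of _ p] g(1) cocyclesD(2)[OF f] by simp
  then show ?thesis using gA eq by blast
qed

text \<open>A cocycle is sent to the coset of Z(G) of an element inducing it. The map is injective,
  since a coset determines conjugation. Its values lie in \<open>K\<close>, which is elementary
  abelian because \<open>A\<close> is abelian and the \<open>p\<close>-th powers of elements of
  \<open>S\<close> are central.\<close>

lemma card_cocycles_le: "card cocycles \<le> p ^ group_rank (G Mod center G)"
proof -
  interpret Z: normal "center G" G by (rule normal_center)
  interpret Q: group "G Mod center G" by (rule Z.factorgroup_is_group)
  interpret GA: comm_group GA by (rule comm_group_GA)
  define S where "S = {a \<in> A. a [^] p \<in> center G}"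
  have S: "subgroup S G"
  proof (rule subgroupI)
    show "S \<subseteq> carrier G" by (auto simp: S_def)
    have "\<one> \<in> A" using center_sub_A Z.one_closed by blast
    then have "\<one> \<in> S" by (simp add: S_def)
    then show "S \<noteq> {}" by blast
    fix a assume a: "a \<in> S"
    then show "inv a \<in> S" by (simp add: S_def nat_pow_inv)
    fix b assume b: "b \<in> S"
    have "(a \<otimes> b) [^] p = a [^] p \<otimes> b [^] p"
      using GA.nat_pow_distrib[of a b p] a b by (simp add: S_def)
    then show "a \<otimes> b \<in> S" using a b by (simp add: S_def)
  qed
  define K where "K = (\<lambda>a. center G #> a) ` S"
  have "group_hom G (G Mod center G) (\<lambda>a. center G #> a)"
    by (intro group_hom.intro group_hom_axioms.intro Z.r_coset_hom_Mod Q.is_group is_group)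
  then have K: "subgroup K (G Mod center G)"
    unfolding K_def using S by (rule group_hom.subgroup_img_is_subgroup)
  have finQ: "finite (carrier (G Mod center G))"
    unfolding carrier_FactGroup using finite_carrier by simp
  have "card K \<le> p ^ group_rank (G Mod center G)"
  proof (rule Q.card_elementary_abelian_le[OF finQ K])
    show "0 < p" using prime by (rule prime_gt_0_nat)
    fix C assume "C \<in> K"
    then obtain a where a: "a \<in> S" "C = center G #> a" by (auto simp: K_def)
    then have aA: "a \<in> A" "a [^] p \<in> center G" by (auto simp: S_def)
    show "C [^]\<^bsub>G Mod center G\<^esub> p = \<one>\<^bsub>G Mod center G\<^esub>"
      using a(2) aA Z.FactGroup_pow[of a p] Z.rcos_const[OF is_group aA(2)] by simp
    fix D assume "D \<in> K"
    then obtain b where b: "b \<in> A" "D = center G #> b" by (auto simp: K_def S_def)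
    show "C \<otimes>\<^bsub>G Mod center G\<^esub> D = D \<otimes>\<^bsub>G Mod center G\<^esub> C"
      using a(2) aA b by (simp add: Z.rcos_sum A_comm)
  qed
  moreover have "card cocycles \<le> card K"
  proof -
    have "\<exists>g. \<forall>f\<in>cocycles. g f \<in> S \<and> (\<forall>x\<in>carrier G. f x \<otimes> x = g f \<otimes> x \<otimes> inv (g f))"
      using cocycle_principal unfolding S_def by (intro bchoice) blast
    then obtain g where "\<forall>f\<in>cocycles. g f \<in> S \<and> (\<forall>x\<in>carrier G. f x \<otimes> x = g f \<otimes> x \<otimes> inv (g f))" ..
    then have gS: "\<And>f. f \<in> cocycles \<Longrightarrow> g f \<in> S"
      and g: "\<And>f x. f \<in> cocycles \<Longrightarrow> x \<in> carrier G \<Longrightarrow> f x \<otimes> x = g f \<otimes> x \<otimes> inv (g f)"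
      by simp_all
    have gG: "g f \<in> carrier G" if "f \<in> cocycles" for f
      using gS[OF that] by (simp add: S_def)
    have "inj_on (\<lambda>f. center G #> g f) cocycles"
    proof (rule inj_onI)
      fix f f' assume f: "f \<in> cocycles" "f' \<in> cocycles" and eq: "center G #> g f = center G #> g f'"
      have "g f \<in> center G #> g f'"
        using rcos_self[OF gG[OF f(1)] subgroup_center] eq by simp
      then obtain z where z: "z \<in> center G" "g f = z \<otimes> g f'"
        by (auto simp: r_coset_def)
      have zG: "z \<in> carrier G" using z(1) unfolding center_iff by blast
      have "f x = f' x" if x: "x \<in> carrier G" for x
      proof -
        have "f x \<otimes> x = z \<otimes> (g f' \<otimes> x \<otimes> inv (g f')) \<otimes> inv z"
          using g[OF f(1) x] z(2) zG gG[OF f(2)] x by (simp add: inv_mult_group m_assoc)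
        also have "\<dots> = g f' \<otimes> x \<otimes> inv (g f')"
          using center_comm[OF z(1), of "g f' \<otimes> x \<otimes> inv (g f')"] zG gG[OF f(2)] x
          by (simp add: m_assoc)
        also have "\<dots> = f' x \<otimes> x" using g[OF f(2) x] by simp
        finally show ?thesis
          using x cocyclesD(1)[OF f(1) x] cocyclesD(1)[OF f(2) x] by simp
      qed
      then show "f = f'"
        using cocyclesD(5)[OF f(1)] cocyclesD(5)[OF f(2)] by (intro extensionalityI)
    qed
    moreover have "finite K"
      using S finite_carrier unfolding K_def by (intro finite_imageI) (meson finite_subset subgroup.subset)
    ultimately show ?thesis
      using gS by (intro card_inj_on_le[where f = "\<lambda>f. center G #> g f"]) (auto simp: K_def)
  qed
  ultimately show ?thesis by linarith
qed

text \<open>Conjugation fixes central values, so \<open>h\<close> is a cocycle. The witness is the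
  inverse of the element that induces its automorphism, which puts the relation in commutator
  form.\<close>

lemma central_hom_principal:
  assumes "\<And>x. x \<in> carrier G \<Longrightarrow> h x \<in> W"
    and "\<And>x y. x \<in> carrier G \<Longrightarrow> y \<in> carrier G \<Longrightarrow> h (x \<otimes> y) = h x \<otimes> h y"
    and "\<And>x. x \<in> frattini G \<Longrightarrow> h x = \<one>"
  shows "\<exists>a\<in>A. a [^] p \<in> center G \<and> (\<forall>x\<in>carrier G. x \<otimes> a \<otimes> inv x = a \<otimes> h x)"
proof -
  have "restrict h (carrier G) \<in> cocycles"
    using assms W_A center_conj[OF W_center] frattini_closed
    by (simp add: cocycles_def W_def)
  then obtain a where a: "a \<in> A" "a [^] p \<in> center G"
    "\<And>x. x \<in> carrier G \<Longrightarrow> h x \<otimes> x = a \<otimes> x \<otimes> inv a"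
    using cocycle_principal by fastforce
  have "x \<otimes> inv a \<otimes> inv x = inv a \<otimes> h x" if x: "x \<in> carrier G" for x
  proof -
    have hx: "h x \<in> carrier G" using assms(1)[OF x] W_A by simp
    have "inv a \<otimes> h x = inv a \<otimes> (h x \<otimes> x) \<otimes> inv x"
      using x hx a(1) by (simp add: m_assoc)
    also have "\<dots> = x \<otimes> inv a \<otimes> inv x"
      using x a by (simp add: m_assoc inv_cancel_left)
    finally show ?thesis by simp
  qed
  moreover have "inv a [^] p \<in> center G"
    using a(1,2) subgroup_center by (simp add: nat_pow_inv subgroup.m_inv_closed)
  ultimately show ?thesis using a(1) by (intro bexI[of _ "inv a"]) auto
qed

end

section \<open>Symmetric bilinear maps and the cocycles built from them\<close>

context frattini_coordinates
begin

text \<open>Ordering each pair as \<open>(j, i)\<close> with \<open>i \<le> j\<close> counts an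
  unordered pair of coordinates once. The set indexes the coefficients of the bilinear maps.\<close>

definition pairs :: "(nat \<times> nat) set" where
  "pairs = (if odd p then SIGMA j:{..<k}. {..j} else SIGMA j:{..<k}. {..<j})"

text \<open>The monomials \<open>quad t\<close> are a basis of the quadratic forms whose polarization,
  \<open>(x, y) \<mapsto> \<Sum>l<k. c l y * polar l t x\<close>, is needed for the cocycles. On the diagonal the factor
  \<open>(p + 1) div 2\<close> is the inverse of 2 modulo \<open>p\<close>, which exists only for odd \<open>p\<close>; for \<open>p = 2\<close> the
  diagonal is therefore left out of \<open>pairs\<close>.\<close>

definition quad :: "nat \<times> nat \<Rightarrow> 'a \<Rightarrow> int" where
  "quad t x = (case t of (j, i) \<Rightarrow>
     if i = j then int ((p + 1) div 2) * (c j x * c j x) else c i x * c j x)"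

definition polar :: "nat \<Rightarrow> nat \<times> nat \<Rightarrow> 'a \<Rightarrow> int" where
  "polar l t x = (case t of (j, i) \<Rightarrow>
     (if l = i then c j x else 0) + (if l = j \<and> i \<noteq> j then c i x else 0))"

lemma pairsD:
  assumes "(j, i) \<in> pairs"
  shows "i \<le> j" and "j < k" and "i < k" and "i = j \<Longrightarrow> odd p"
  using assms by (auto simp: pairs_def split: if_splits)

lemma finite_pairs: "finite pairs"
  by (simp add: pairs_def)

lemma card_pairs: "card pairs = (if odd p then (k + 1) choose 2 else k choose 2)"
proof -
  have "(\<Sum>j<n. j) = n choose 2" for n :: nat
    by (induction n) (simp_all add: numeral_2_eq_2)
  moreover have "(\<Sum>j<n. Suc j) = (n + 1) choose 2" for n :: nat
    by (induction n) (simp_all add: numeral_2_eq_2)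
  ultimately show ?thesis by (simp add: pairs_def)
qed

lemma hom_mod_polar:
  assumes "t \<in> pairs"
  shows "hom_mod p G (polar l t)"
proof -
  obtain j i where t: "t = (j, i)" by fastforce
  note ij = pairsD[OF assms[unfolded t]]
  show ?thesis
    unfolding hom_mod_def
  proof (intro ballI)
    fix x y assume xy: "x \<in> carrier G" "y \<in> carrier G"
    have "[(if l = i then c j (x \<otimes> y) else 0) + (if l = j \<and> i \<noteq> j then c i (x \<otimes> y) else 0) =
        (if l = i then c j x + c j y else 0) + (if l = j \<and> i \<noteq> j then c i x + c i y else 0)] (mod int p)"
      using hom_mod_mult[OF coord[OF ij(2)] xy] hom_mod_mult[OF coord[OF ij(3)] xy]
      by (intro cong_add) simp_all
    also have "(if l = i then c j x + c j y else 0) + (if l = j \<and> i \<noteq> j then c i x + c i y else 0) =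
        polar l t x + polar l t y"
      by (simp add: polar_def t)
    finally show "[polar l t (x \<otimes> y) = polar l t x + polar l t y] (mod int p)"
      by (simp add: polar_def t)
  qed
qed

lemma sum_polar:
  assumes "(j, i) \<in> pairs"
  shows "(\<Sum>l<k. c l y * polar l (j, i) x) = c i y * c j x + (if i = j then 0 else c j y * c i x)"
proof -
  note ij = pairsD[OF assms]
  have "(\<Sum>l<k. c l y * polar l (j, i) x) =
      (\<Sum>l<k. if l = i then c l y * c j x else 0) +
      (\<Sum>l<k. if l = j then if i \<noteq> j then c l y * c i x else 0 else 0)"
    unfolding sum.distrib[symmetric]
    by (rule sum.cong) (simp_all add: polar_def algebra_simps)
  also have "\<dots> = c i y * c j x + (if i = j then 0 else c j y * c i x)"
    using ij by (simp add: sum.delta)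
  finally show ?thesis .
qed

text \<open>Off the diagonal this is the expansion of a product. On the diagonal \<open>p\<close> is
  odd and the cross term carries the factor 2 times the inverse of 2.\<close>

lemma quad_mult:
  assumes t: "t \<in> pairs" and xy: "x \<in> carrier G" "y \<in> carrier G"
  shows "[quad t (x \<otimes> y) = quad t x + quad t y + (\<Sum>l<k. c l y * polar l t x)] (mod int p)"
proof -
  obtain j i where ji: "t = (j, i)" by fastforce
  note ij = pairsD[OF t[unfolded ji]]
  have ci: "[c i (x \<otimes> y) = c i x + c i y] (mod int p)"
    and cj: "[c j (x \<otimes> y) = c j x + c j y] (mod int p)"
    using hom_mod_mult[OF coord xy] ij by blast+
  show ?thesis
  proof (cases "i = j")
    case False
    have "[quad t (x \<otimes> y) = (c i x + c i y) * (c j x + c j y)] (mod int p)"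
      using cong_mult[OF ci cj] False by (simp add: quad_def ji)
    also have "(c i x + c i y) * (c j x + c j y) =
        quad t x + quad t y + (\<Sum>l<k. c l y * polar l t x)"
      unfolding ji sum_polar[OF t[unfolded ji]] using False by (simp add: quad_def algebra_simps)
    finally show ?thesis .
  next
    case True
    define h where "h = int ((p + 1) div 2)"
    have "even (p + 1)" using ij(4)[OF True] by simp
    then have "2 * ((p + 1) div 2) = p + 1" by (rule dvd_mult_div_cancel)
    \<comment> \<open>The surplus \<open>int p\<close> produces a multiple of \<open>p\<close> that
      disappears modulo \<open>p\<close>.\<close>
    then have h: "2 * h = int p + 1" unfolding h_def by linarith
    have "[quad t (x \<otimes> y) = h * ((c j x + c j y) * (c j x + c j y))] (mod int p)"
      using cong_scalar_left[OF cong_mult[OF cj cj]] True by (simp add: quad_def ji h_def)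
    also have "h * ((c j x + c j y) * (c j x + c j y)) =
        h * (c j x * c j x) + h * (c j y * c j y) + 2 * h * (c j y * c j x)"
      by (simp add: algebra_simps)
    also have "\<dots> = quad t x + quad t y + (\<Sum>l<k. c l y * polar l t x) + int p * (c j y * c j x)"
      unfolding ji sum_polar[OF t[unfolded ji]] h using True
      by (simp add: quad_def h_def algebra_simps)
    also have "[\<dots> = quad t x + quad t y + (\<Sum>l<k. c l y * polar l t x)] (mod int p)"
      by (simp add: cong_def)
    finally show ?thesis .
  qed
qed

text \<open>Evaluating at the dual basis isolates one coefficient, so that \<open>w (j, i)\<close>
  can be read off from a commutator with \<open>base j\<close>.\<close>

lemma polar_base:
  assumes "(j, i) \<in> pairs" and "u \<in> pairs"
  shows "[polar i u (base j) = of_bool (u = (j, i))] (mod int p)"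
proof -
  obtain b a where u: "u = (b, a)" by fastforce
  note ij = pairsD[OF assms(1)] and ab = pairsD[OF assms(2)[unfolded u]]
  have "[polar i u (base j) =
      (if i = a then of_bool (b = j) else 0) + (if i = b \<and> a \<noteq> b then of_bool (a = j) else 0)] (mod int p)"
    unfolding polar_def u prod.case
    using dual[OF ab(2) ij(2)] dual[OF ab(3) ij(2)] by (intro cong_add) simp_all
  \<comment> \<open>A nonzero second summand would mean \<open>j = a < b = i\<close>, against the
    ordering of \<open>(j, i)\<close>.\<close>
  also have "(if i = a then of_bool (b = j) else 0) + (if i = b \<and> a \<noteq> b then of_bool (a = j) else 0) =
      (of_bool (u = (j, i)) :: int)"
    using ij(1) ab(1) by (auto simp: u)
  finally show ?thesis .
qed

lemma frattini_coord: "x \<in> frattini G \<Longrightarrow> i < k \<Longrightarrow> int p dvd c i x"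
  using frattini_iff by (auto simp: frattini_def)

lemma frattini_polar: "x \<in> frattini G \<Longrightarrow> t \<in> pairs \<Longrightarrow> int p dvd polar l t x"
  using frattini_coord pairsD by (cases t) (simp add: polar_def)

lemma frattini_quad: "x \<in> frattini G \<Longrightarrow> t \<in> pairs \<Longrightarrow> int p dvd quad t x"
  using frattini_coord pairsD by (cases t) (simp add: quad_def)

end

section \<open>Cocycles with prescribed basis values and bilinear second difference\<close>

context frattini_centralizer
begin

sublocale GA: comm_group GA
  rewrites "carrier GA = A" and "monoid.mult GA = monoid.mult G" and "one GA = one G"
  by (simp_all add: comm_group_GA)

lemma subgroup_W: "subgroup W GA"
proof (rule GA.subgroupI)
  show "W \<subseteq> A" using W_A by blast
  have "\<one> \<in> W" using subgroup.one_closed[OF subgroup_center] by (simp add: W_def)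
  then show "W \<noteq> {}" by blast
  fix a assume a: "a \<in> W"
  then show "inv\<^bsub>GA\<^esub> a \<in> W"
    using W_A[OF a] subgroup.m_inv_closed[OF subgroup_center] by (simp add: W_def nat_pow_inv)
  fix b assume b: "b \<in> W"
  have "(a \<otimes> b) [^] p = a [^] p \<otimes> b [^] p"
    using GA.nat_pow_distrib[of a b p] W_A[OF a] W_A[OF b] by simp
  then show "a \<otimes> b \<in> W"
    using a b subgroup.m_closed[OF subgroup_center] by (simp add: W_def)
qed

text \<open>Conjugation is a homomorphism, and since \<open>A\<close> is abelian the factors
  \<open>u j\<close> can be collected on the right.\<close>

lemma conj_pow_prod:
  assumes "finite J" and "\<And>j. j \<in> J \<Longrightarrow> v j \<in> A" and "\<And>j. j \<in> J \<Longrightarrow> u j \<in> A"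
    and x: "x \<in> carrier G" and "\<And>j. j \<in> J \<Longrightarrow> x \<otimes> v j \<otimes> inv x = v j \<otimes> u j"
  shows "x \<otimes> pow_prod GA v J e \<otimes> inv x = pow_prod GA v J e \<otimes> pow_prod GA u J e"
  using assms(1-3,5)
proof (induction J rule: finite_induct)
  case empty
  show ?case using x by simp
next
  case (insert j J)
  have v: "v j \<in> A" "pow_prod GA v J e \<in> A" and u: "u j \<in> A" "pow_prod GA u J e \<in> A"
    using insert.prems by simp_all
  have "(\<lambda>g. x \<otimes> g \<otimes> inv x) \<in> hom G G"
    using x by (intro homI) (simp_all add: m_assoc inv_cancel_left)
  then have "x \<otimes> v j [^] e j \<otimes> inv x = (x \<otimes> v j \<otimes> inv x) [^] e j"
    using hom_int_pow[of "\<lambda>g. x \<otimes> g \<otimes> inv x" G G "v j" "e j"] v(1) by simp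
  also have "\<dots> = (v j \<otimes> u j) [^] e j" using insert.prems(3) by simp
  also have "\<dots> = v j [^] e j \<otimes> u j [^] e j"
    using v(1) u(1) by (intro int_pow_mult_distrib A_comm) auto
  finally have pow: "x \<otimes> v j [^]\<^bsub>GA\<^esub> e j \<otimes> inv x = v j [^]\<^bsub>GA\<^esub> e j \<otimes> u j [^]\<^bsub>GA\<^esub> e j"
    using int_pow_consistent[OF subgroup_A] v(1) u(1) by simp
  define r s where "r = v j [^]\<^bsub>GA\<^esub> e j" and "s = u j [^]\<^bsub>GA\<^esub> e j"
  have rs: "r \<in> A" "s \<in> A" using v(1) u(1) by (simp_all add: r_def s_def)
  have "x \<otimes> (r \<otimes> pow_prod GA v J e) \<otimes> inv x =
      (x \<otimes> r \<otimes> inv x) \<otimes> (x \<otimes> pow_prod GA v J e \<otimes> inv x)"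
    using x rs v by (simp add: m_assoc inv_cancel_left)
  also have "\<dots> = (r \<otimes> s) \<otimes> (pow_prod GA v J e \<otimes> pow_prod GA u J e)"
    using insert.IH insert.prems pow by (simp add: r_def s_def)
  also have "\<dots> = (r \<otimes> pow_prod GA v J e) \<otimes> (s \<otimes> pow_prod GA u J e)"
    using rs v(2) u(2) by (simp add: GA.m_ac)
  finally show ?case
    using insert.hyps insert.prems by (simp add: GA.pow_prod_insert r_def s_def)
qed


text \<open>The value \<open>v i\<close> of the cocycle at \<open>base i\<close> (up to an element of \<open>W\<close>) and the coefficients \<open>w\<close> of
  its bilinear second difference, which must agree with the commutators of the \<open>v i\<close>.\<close>

definition cocycle_datum :: "(nat \<Rightarrow> 'a) \<Rightarrow> (nat \<times> nat \<Rightarrow> 'a) \<Rightarrow> bool" where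
  "cocycle_datum v w \<longleftrightarrow> (\<forall>i<k. v i \<in> A \<and> v i [^] p = \<one>) \<and> (\<forall>t\<in>pairs. w t \<in> W) \<and>
     (\<forall>i<k. \<forall>x\<in>carrier G. x \<otimes> v i \<otimes> inv x = v i \<otimes> pow_prod GA w pairs (\<lambda>t. polar i t x))"

text \<open>A quadratic polynomial in the coordinates, written multiplicatively: \<open>v\<close>
  holds the linear and \<open>w\<close> the quadratic coefficients.\<close>

definition datum_cocycle :: "(nat \<Rightarrow> 'a) \<Rightarrow> (nat \<times> nat \<Rightarrow> 'a) \<Rightarrow> 'a \<Rightarrow> 'a" where
  "datum_cocycle v w = (\<lambda>x\<in>carrier G.
     pow_prod GA v {..<k} (\<lambda>i. c i x) \<otimes> pow_prod GA w pairs (\<lambda>t. quad t x))"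

lemma pow_prod_W:
  "(\<And>t. t \<in> pairs \<Longrightarrow> w t \<in> W) \<Longrightarrow> pow_prod GA w pairs e \<in> W"
  using GA.pow_prod_in_subgroup[OF subgroup_W finite_pairs] by blast

lemma W_pow: "w \<in> W \<Longrightarrow> w [^] p = \<one>"
  by (simp add: W_def)

text \<open>The linear part \<open>f\<close> is multiplicative but moved by conjugation; the
  quadratic part \<open>g\<close> is central but not multiplicative. Both defects equal the same
  element \<open>d\<close>, which yields the cocycle identity.\<close>

lemma datum_cocycle_in_cocycles:
  assumes "cocycle_datum v w"
  shows "datum_cocycle v w \<in> cocycles"
proof -
  have v: "\<And>i. i \<in> {..<k} \<Longrightarrow> v i \<in> A" "\<And>i. i \<in> {..<k} \<Longrightarrow> v i [^] p = \<one>"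
    and w: "\<And>t. t \<in> pairs \<Longrightarrow> w t \<in> W"
    and conj: "\<And>i x. i \<in> {..<k} \<Longrightarrow> x \<in> carrier G \<Longrightarrow>
      x \<otimes> v i \<otimes> inv x = v i \<otimes> pow_prod GA w pairs (\<lambda>t. polar i t x)"
    using assms unfolding cocycle_datum_def by simp_all
  have vp: "v i [^]\<^bsub>GA\<^esub> p = \<one>" if "i \<in> {..<k}" for i using v(2)[OF that] by simp
  have wp: "w t [^]\<^bsub>GA\<^esub> p = \<one>" if "t \<in> pairs" for t using W_pow[OF w[OF that]] by simp
  have wA: "w t \<in> A" if "t \<in> pairs" for t using W_A[OF w[OF that]] .
  define f where "f x = pow_prod GA v {..<k} (\<lambda>i. c i x)" for x
  define g where "g x = pow_prod GA w pairs (\<lambda>t. quad t x)" for x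
  have fA: "f x \<in> A" for x unfolding f_def using v(1) by (intro GA.pow_prod_closed)
  have gW: "g x \<in> W" for x unfolding g_def using w by (rule pow_prod_W)
  have gA: "g x \<in> A" for x using W_A[OF gW] .
  have eq: "datum_cocycle v w x = f x \<otimes> g x" if "x \<in> carrier G" for x
    using that by (simp add: datum_cocycle_def f_def g_def)
  have torsion: "(f x \<otimes> g x) [^] p = \<one>" for x
  proof -
    have "(f x \<otimes> g x) [^] p = f x [^] p \<otimes> g x [^] p"
      using GA.nat_pow_distrib[OF fA gA, of x x p] by simp
    also have "f x [^] p = \<one>"
    proof -
      have "f x [^]\<^bsub>GA\<^esub> p = \<one>"
        unfolding f_def using v(1) vp by (intro GA.pow_prod_torsion) simp_all
      then show ?thesis by simp
    qed
    also have "g x [^] p = \<one>" using W_pow[OF gW] .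
    finally show ?thesis by simp
  qed
  have mult: "f (x \<otimes> y) \<otimes> g (x \<otimes> y) = f x \<otimes> g x \<otimes> (x \<otimes> (f y \<otimes> g y) \<otimes> inv x)"
    if xy: "x \<in> carrier G" "y \<in> carrier G" for x y
  proof -
    define d where "d = pow_prod GA w pairs (\<lambda>t. \<Sum>l<k. c l y * polar l t x)"
    have dA: "d \<in> A" unfolding d_def using wA by (intro GA.pow_prod_closed)
    have c_mult: "[c i (x \<otimes> y) = c i x + c i y] (mod int p)" if "i \<in> {..<k}" for i
      using that hom_mod_mult[OF coord xy] by simp
    have "f (x \<otimes> y) = pow_prod GA v {..<k} (\<lambda>i. c i x + c i y)"
      unfolding f_def by (rule GA.pow_prod_cong[where p = p]) (fact v(1) vp c_mult)+
    also have "\<dots> = f x \<otimes> f y"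
      unfolding f_def by (rule GA.pow_prod_add) (fact v(1))
    finally have f_mult: "f (x \<otimes> y) = f x \<otimes> f y" .
    have "g (x \<otimes> y) = pow_prod GA w pairs (\<lambda>t. quad t x + quad t y + (\<Sum>l<k. c l y * polar l t x))"
      unfolding g_def
      by (rule GA.pow_prod_cong[where p = p]) (use wA wp quad_mult[OF _ xy] in blast)+
    also have "\<dots> = pow_prod GA w pairs (\<lambda>t. quad t x + quad t y) \<otimes> d"
      unfolding d_def by (rule GA.pow_prod_add) (fact wA)
    also have "pow_prod GA w pairs (\<lambda>t. quad t x + quad t y) = g x \<otimes> g y"
      unfolding g_def by (rule GA.pow_prod_add) (fact wA)
    finally have g_mult: "g (x \<otimes> y) = g x \<otimes> g y \<otimes> d" .
    have "x \<otimes> f y \<otimes> inv x =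
        f y \<otimes> pow_prod GA (\<lambda>i. pow_prod GA w pairs (\<lambda>t. polar i t x)) {..<k} (\<lambda>i. c i y)"
      unfolding f_def using v(1) conj xy(1) wA by (intro conj_pow_prod) auto
    also have "pow_prod GA (\<lambda>i. pow_prod GA w pairs (\<lambda>t. polar i t x)) {..<k} (\<lambda>i. c i y) = d"
      unfolding d_def using finite_pairs wA by (intro GA.pow_prod_pow_prod) auto
    finally have f_conj: "x \<otimes> f y \<otimes> inv x = f y \<otimes> d" .
    have "x \<otimes> (f y \<otimes> g y) \<otimes> inv x = (x \<otimes> f y \<otimes> inv x) \<otimes> (x \<otimes> g y \<otimes> inv x)"
      using xy(1) A_closed[OF fA] A_closed[OF gA] by (simp add: m_assoc inv_cancel_left)
    also have "\<dots> = f y \<otimes> d \<otimes> g y"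
      using f_conj center_conj[OF W_center[OF gW] xy(1)] by simp
    finally show ?thesis
      unfolding f_mult g_mult using fA gA dA by (simp add: GA.m_ac)
  qed
  have trivial: "f x \<otimes> g x = \<one>" if x: "x \<in> frattini G" for x
  proof -
    have "f x = pow_prod GA v {..<k} (\<lambda>i. 0)"
      unfolding f_def
      by (rule GA.pow_prod_cong[where p = p])
        (use v(1) vp frattini_coord[OF x] in \<open>simp_all add: cong_0_iff\<close>)
    moreover have "g x = pow_prod GA w pairs (\<lambda>t. 0)"
      unfolding g_def
      by (rule GA.pow_prod_cong[where p = p])
        (use wA wp frattini_quad[OF x] in \<open>simp_all add: cong_0_iff\<close>)
    ultimately show ?thesis by (simp add: GA.pow_prod_zero)
  qed
  have "datum_cocycle v w \<in> carrier G \<rightarrow>\<^sub>E A"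
    using eq fA gA by (intro PiE_I) (simp_all add: datum_cocycle_def)
  then show ?thesis
    unfolding cocycles_def using eq torsion mult trivial frattini_closed by simp
qed

text \<open>Conjugating the value at \<open>base i\<close> by \<open>base j\<close> multiplies it by
  \<open>w (j, i)\<close>, so the cocycle determines \<open>w\<close>. With \<open>w\<close> known,
  the value at \<open>base i\<close> determines \<open>v i\<close>.\<close>

lemma datum_cocycle_inject:
  assumes d: "cocycle_datum v w" and d': "cocycle_datum v' w'"
    and eq: "datum_cocycle v w = datum_cocycle v' w'"
  shows "\<And>t. t \<in> pairs \<Longrightarrow> w t = w' t" and "\<And>i. i < k \<Longrightarrow> v i = v' i"
proof -
  have base_val: "datum_cocycle v w (base i) = v i \<otimes> pow_prod GA w pairs (\<lambda>t. quad t (base i))"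
    if d: "cocycle_datum v w" and i: "i < k" for v w i
  proof -
    have v: "v j \<in> A" "v j [^] p = \<one>" if "j < k" for j
      using d that by (simp_all add: cocycle_datum_def)
    have "pow_prod GA v {..<k} (\<lambda>j. c j (base i)) = v i"
      using v dual[OF _ i] i by (intro GA.pow_prod_single[where p = p]) auto
    then show ?thesis using base_closed[OF i] by (simp add: datum_cocycle_def)
  qed
  have conj_val: "base j \<otimes> datum_cocycle v w (base i) \<otimes> inv (base j) = datum_cocycle v w (base i) \<otimes> w (j, i)"
    if d: "cocycle_datum v w" and ji: "(j, i) \<in> pairs" for v w i j
  proof -
    have ij: "i < k" "j < k" using pairsD[OF ji] by simp_all
    define x where "x = base j"
    have x: "x \<in> carrier G" using base_closed[OF ij(2)] by (simp add: x_def)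
    have v: "v i \<in> A" and w: "\<And>t. t \<in> pairs \<Longrightarrow> w t \<in> W"
      and conj: "x \<otimes> v i \<otimes> inv x = v i \<otimes> pow_prod GA w pairs (\<lambda>t. polar i t x)"
      using d ij(1) x by (simp_all add: cocycle_datum_def)
    have wji: "w (j, i) \<in> A" using W_A[OF w[OF ji]] .
    have "pow_prod GA w pairs (\<lambda>t. polar i t x) = w (j, i)"
      using finite_pairs ji W_A[OF w] W_pow[OF w] polar_base[OF ji]
      by (intro GA.pow_prod_single[where p = p]) (simp_all add: x_def)
    then have conj': "x \<otimes> v i \<otimes> inv x = v i \<otimes> w (j, i)" using conj by simp
    define g where "g = pow_prod GA w pairs (\<lambda>t. quad t (base i))"
    have gW: "g \<in> W" unfolding g_def using w by (rule pow_prod_W)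
    have gA: "g \<in> A" using W_A[OF gW] .
    have "x \<otimes> (v i \<otimes> g) \<otimes> inv x = (x \<otimes> v i \<otimes> inv x) \<otimes> (x \<otimes> g \<otimes> inv x)"
      using x A_closed[OF v] A_closed[OF gA] by (simp add: m_assoc inv_cancel_left)
    also have "\<dots> = v i \<otimes> w (j, i) \<otimes> g"
      using conj' center_conj[OF W_center[OF gW] x] by simp
    also have "\<dots> = v i \<otimes> g \<otimes> w (j, i)"
      using v wji gA by (simp add: GA.m_ac)
    finally show ?thesis
      unfolding base_val[OF d ij(1)] by (simp add: x_def g_def)
  qed
  have wA: "w t \<in> A" "w' t \<in> A" if "t \<in> pairs" for t
    using d d' that W_A by (simp_all add: cocycle_datum_def)
  show ww': "w t = w' t" if t: "t \<in> pairs" for t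
  proof -
    obtain j i where ji: "t = (j, i)" by fastforce
    define z where "z = datum_cocycle v w (base i)"
    have "z \<in> A"
      using cocyclesD(1)[OF datum_cocycle_in_cocycles[OF d]] base_closed pairsD(3) t
      unfolding z_def ji by blast
    moreover have "z \<otimes> w t = z \<otimes> w' t"
      using conj_val[OF d] conj_val[OF d'] t eq unfolding z_def ji by simp
    ultimately show ?thesis using wA[OF t] by simp
  qed
  show "v i = v' i" if i: "i < k" for i
  proof -
    have "pow_prod GA w pairs (\<lambda>t. quad t (base i)) = pow_prod GA w' pairs (\<lambda>t. quad t (base i))"
      unfolding pow_prod_def using ww' wA by (intro GA.finprod_cong') auto
    moreover have "v i \<in> A" "v' i \<in> A" using d d' i by (simp_all add: cocycle_datum_def)
    moreover have "pow_prod GA w' pairs (\<lambda>t. quad t (base i)) \<in> A"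
      using wA(2) by (rule GA.pow_prod_closed)
    ultimately show ?thesis
      using base_val[OF d i] base_val[OF d' i] eq by simp
  qed
qed

end

section \<open>Counting cocycles\<close>

context frattini_inner
begin

text \<open>The set \<open>S\<close> serves twice: as the central freedom in choosing the commutator
  solutions, and as the range of their \<open>p\<close>-th powers. Its cardinality cancels in the
  pigeonhole argument, leaving a fibre \<open>F\<close> at least as large as
  \<open>E\<close>.\<close>

lemma card_W_power_le: "card W ^ card pairs \<le> card cocycles"
proof -
  define E where "E = pairs \<rightarrow>\<^sub>E W"
  define S where "S = {..<k} \<rightarrow>\<^sub>E center G"
  interpret Z: subgroup "center G" G by (rule subgroup_center)
  have fin_center: "finite (center G)"
    using finite_carrier Z.subset finite_subset by blast
  then have finW: "finite W" by (simp add: W_def)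
  have finE: "finite E" and finS: "finite S"
    unfolding E_def S_def using finW fin_center finite_pairs by (auto intro: finite_PiE)
  have "(\<lambda>i\<in>{..<k}. \<one>) \<in> S" unfolding S_def by simp
  then have S_ne: "S \<noteq> {}" by blast
  have wW: "w t \<in> W" if "w \<in> E" "t \<in> pairs" for w t
    using that PiE_mem unfolding E_def by fast
  have sZ: "s i \<in> center G" if "s \<in> S" "i < k" for s i
    using that PiE_mem[of s "{..<k}" "\<lambda>_. center G" i] unfolding S_def by simp
  \<comment> \<open>This is the symmetric bilinear map with coefficients \<open>w\<close>, one
    argument being \<open>base i\<close>.\<close>
  define h where "h w i x = pow_prod GA w pairs (\<lambda>t. polar i t x)" for w i x
  have hW: "h w i x \<in> W" if "w \<in> E" for w i x
    unfolding h_def using wW[OF that] by (rule pow_prod_W)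
  have h_ex: "\<exists>a\<in>A. a [^] p \<in> center G \<and> (\<forall>x\<in>carrier G. x \<otimes> a \<otimes> inv x = a \<otimes> h w i x)"
    if w: "w \<in> E" for w i
  proof (rule central_hom_principal)
    have wA: "w t \<in> A" "w t [^]\<^bsub>GA\<^esub> p = \<one>" if "t \<in> pairs" for t
      using W_A[OF wW[OF w that]] W_pow[OF wW[OF w that]] by simp_all
    show "h w i x \<in> W" for x using w by (rule hW)
    show "h w i (x \<otimes> y) = h w i x \<otimes> h w i y" if "x \<in> carrier G" "y \<in> carrier G" for x y
    proof -
      have "h w i (x \<otimes> y) = pow_prod GA w pairs (\<lambda>t. polar i t x + polar i t y)"
        unfolding h_def using that
        by (intro GA.pow_prod_cong[where p = p] wA hom_mod_mult[OF hom_mod_polar])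
      also have "\<dots> = h w i x \<otimes> h w i y"
        unfolding h_def by (rule GA.pow_prod_add) (fact wA)
      finally show ?thesis .
    qed
    show "h w i x = \<one>" if "x \<in> frattini G" for x
    proof -
      have "h w i x = pow_prod GA w pairs (\<lambda>t. 0)"
        unfolding h_def
        by (rule GA.pow_prod_cong[where p = p])
          (use wA frattini_polar[OF that] in \<open>simp_all add: cong_0_iff\<close>)
      then show ?thesis by (simp add: GA.pow_prod_zero)
    qed
  qed
  \<comment> \<open>The choice depends on \<open>w\<close> and \<open>i\<close> only; injectivity
    relies on this when it recovers the central part.\<close>
  define a where "a w i = (SOME a. a \<in> A \<and> a [^] p \<in> center G \<and>
    (\<forall>x\<in>carrier G. x \<otimes> a \<otimes> inv x = a \<otimes> h w i x))" for w i
  have a: "a w i \<in> A" "a w i [^] p \<in> center G"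
    "\<And>x. x \<in> carrier G \<Longrightarrow> x \<otimes> a w i \<otimes> inv x = a w i \<otimes> h w i x" if "w \<in> E" for w i
    using someI_ex[OF h_ex[OF that, of i, unfolded Bex_def]] unfolding a_def by blast+
  \<comment> \<open>A central factor leaves the commutators of \<open>a\<close> unchanged, so
    \<open>r\<close> is again a solution.\<close>
  define r where "r ws i = a (fst ws) i \<otimes> snd ws i" for ws :: "(nat \<times> nat \<Rightarrow> 'a) \<times> (nat \<Rightarrow> 'a)" and i
  have r: "r ws i \<in> A" "r ws i [^] p \<in> center G"
    "\<And>x. x \<in> carrier G \<Longrightarrow> x \<otimes> r ws i \<otimes> inv x = r ws i \<otimes> h (fst ws) i x"
    if ws: "ws \<in> E \<times> S" and i: "i < k" for ws i
  proof -
    have w: "fst ws \<in> E" and s: "snd ws \<in> S" using ws by auto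
    note sZ = sZ[OF s i]
    have sA: "snd ws i \<in> A" using sZ center_sub_A by blast
    show "r ws i \<in> A" unfolding r_def using a(1)[OF w] sA by simp
    have "r ws i [^] p = a (fst ws) i [^] p \<otimes> snd ws i [^] p"
      using GA.nat_pow_distrib[OF a(1)[OF w] sA, of i p] by (simp add: r_def)
    moreover have "snd ws i [^] p \<in> center G"
      using subgroup_int_pow_closed[OF subgroup_center sZ, of "int p"] by (simp add: int_pow_int)
    ultimately show "r ws i [^] p \<in> center G" using a(2)[OF w] by simp
    fix x assume x: "x \<in> carrier G"
    have hA: "h (fst ws) i x \<in> A" using W_A[OF hW[OF w]] .
    have "x \<otimes> r ws i \<otimes> inv x = (x \<otimes> a (fst ws) i \<otimes> inv x) \<otimes> (x \<otimes> snd ws i \<otimes> inv x)"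
      unfolding r_def using x A_closed[OF a(1)[OF w]] A_closed[OF sA]
      by (simp add: m_assoc inv_cancel_left)
    also have "\<dots> = a (fst ws) i \<otimes> h (fst ws) i x \<otimes> snd ws i"
      using a(3)[OF w x] center_conj[OF sZ x] by simp
    also have "\<dots> = r ws i \<otimes> h (fst ws) i x"
      unfolding r_def using a(1)[OF w] sA hA by (simp add: GA.m_ac)
    finally show "x \<otimes> r ws i \<otimes> inv x = r ws i \<otimes> h (fst ws) i x" .
  qed
  define \<theta> where "\<theta> ws = (\<lambda>i\<in>{..<k}. r ws i [^] p)" for ws
  have "\<theta> ` (E \<times> S) \<subseteq> S"
    using r(2) unfolding \<theta>_def S_def by (intro image_subsetI restrict_PiE_iff[THEN iffD2]) simp
  then obtain b where b: "b \<in> S" "card (E \<times> S) \<le> card S * card {ws \<in> E \<times> S. \<theta> ws = b}"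
    using card_le_card_times_fibre[of "E \<times> S" S \<theta>] finE finS S_ne by auto
  define F where "F = {ws \<in> E \<times> S. \<theta> ws = b}"
  have "card S * card E \<le> card S * card F"
    using b(2) by (simp add: F_def card_cartesian_product mult.commute)
  moreover have "card S > 0" using finS S_ne by (simp add: card_gt_0_iff)
  ultimately have EF: "card E \<le> card F" by simp
  have cardE: "card E = card W ^ card pairs"
    by (simp add: E_def card_PiE finite_pairs)
  show ?thesis
  proof (cases "F = {}")
    case True
    then have "card W ^ card pairs \<le> 0" using EF cardE by (metis card.empty)
    then show ?thesis by linarith
  next
    case False
    then obtain ws0 where ws0: "ws0 \<in> E \<times> S" "\<theta> ws0 = b" unfolding F_def by blast
    have w0: "fst ws0 \<in> E" using ws0(1) by auto
    \<comment> \<open>Members of the fibre share their \<open>p\<close>-th powers, so the quotient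
      by \<open>ws0\<close> has order dividing \<open>p\<close>, while the bilinear coefficients are
      divided accordingly.\<close>
    define v where "v ws i = r ws i \<otimes> inv (r ws0 i)" for ws i
    define w where "w ws t = fst ws t \<otimes> inv (fst ws0 t)" for ws :: "(nat \<times> nat \<Rightarrow> 'a) \<times> (nat \<Rightarrow> 'a)" and t
    have datum: "cocycle_datum (v ws) (w ws)" if ws: "ws \<in> F" for ws
      unfolding cocycle_datum_def
    proof (intro conjI allI impI ballI)
      have ws': "ws \<in> E \<times> S" "\<theta> ws = b" using ws by (auto simp: F_def)
      have wE: "fst ws \<in> E" using ws'(1) by auto
      have div_W: "y \<otimes> inv z \<in> W" if "y \<in> W" "z \<in> W" for y z
        using that subgroup.m_closed[OF subgroup_W] subgroup.m_inv_closed[OF subgroup_W that(2)]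
          W_A[OF that(2)] by simp
      show "w ws t \<in> W" if "t \<in> pairs" for t
        unfolding w_def using wW wE w0 that by (intro div_W)
      fix i assume i: "i < k"
      have rA: "r ws i \<in> A" "r ws0 i \<in> A" using r(1)[OF _ i] ws' ws0 by blast+
      show "v ws i \<in> A" unfolding v_def using rA by simp
      have "\<theta> ws i = \<theta> ws0 i" using ws'(2) ws0(2) by simp
      then have "r ws i [^] p = r ws0 i [^] p" using i by (simp add: \<theta>_def)
      moreover have "v ws i [^] p = r ws i [^] p \<otimes> inv (r ws0 i) [^] p"
        using GA.nat_pow_distrib[of "r ws i" "inv (r ws0 i)" p] rA by (simp add: v_def)
      ultimately show "v ws i [^] p = \<one>" using rA by (simp add: nat_pow_inv)
      fix x assume x: "x \<in> carrier G"
      define y z where "y = h (fst ws) i x" and "z = h (fst ws0) i x"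
      have yz: "y \<in> A" "z \<in> A" unfolding y_def z_def using W_A[OF hW] wE w0 by blast+
      have wA: "fst ws t \<in> A" "fst ws0 t \<in> A" if "t \<in> pairs" for t
        using W_A[OF wW] wE w0 that by blast+
      have "pow_prod GA (\<lambda>t. fst ws t \<otimes> inv\<^bsub>GA\<^esub> (fst ws0 t)) pairs (\<lambda>t. polar i t x) = y \<otimes> inv\<^bsub>GA\<^esub> z"
        unfolding y_def z_def h_def by (rule GA.pow_prod_div) (fact finite_pairs wA)+
      moreover have "pow_prod GA (\<lambda>t. fst ws t \<otimes> inv\<^bsub>GA\<^esub> (fst ws0 t)) pairs (\<lambda>t. polar i t x) =
          pow_prod GA (w ws) pairs (\<lambda>t. polar i t x)"
        unfolding pow_prod_def using wA by (intro GA.finprod_cong') (auto simp: w_def)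
      ultimately have pw: "pow_prod GA (w ws) pairs (\<lambda>t. polar i t x) = y \<otimes> inv z"
        using yz by simp
      have "x \<otimes> v ws i \<otimes> inv x = (x \<otimes> r ws i \<otimes> inv x) \<otimes> inv (x \<otimes> r ws0 i \<otimes> inv x)"
        unfolding v_def using x A_closed[OF rA(1)] A_closed[OF rA(2)]
        by (simp add: m_assoc inv_cancel_left inv_mult_group)
      also have "\<dots> = (r ws i \<otimes> y) \<otimes> inv (r ws0 i \<otimes> z)"
        unfolding y_def z_def using r(3)[OF ws'(1) i x] r(3)[OF ws0(1) i x] by simp
      also have "\<dots> = v ws i \<otimes> (y \<otimes> inv z)"
        unfolding v_def using rA yz by (simp add: inv_mult_group GA.m_ac)
      finally show "x \<otimes> v ws i \<otimes> inv x = v ws i \<otimes> pow_prod GA (w ws) pairs (\<lambda>t. polar i t x)"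
        using pw by simp
    qed
    have "inj_on (\<lambda>ws. datum_cocycle (v ws) (w ws)) F"
    proof (rule inj_onI)
      fix ws ws' assume F: "ws \<in> F" "ws' \<in> F"
        and eq: "datum_cocycle (v ws) (w ws) = datum_cocycle (v ws') (w ws')"
      have ES: "ws \<in> E \<times> S" "ws' \<in> E \<times> S" using F by (auto simp: F_def)
      then have wE: "fst ws \<in> E" "fst ws' \<in> E" and sS: "snd ws \<in> S" "snd ws' \<in> S" by auto
      note inj = datum_cocycle_inject[OF datum[OF F(1)] datum[OF F(2)] eq]
      have fst_eq: "fst ws = fst ws'"
      proof (rule PiE_ext[of _ pairs "\<lambda>_. W"])
        fix t assume t: "t \<in> pairs"
        have "fst ws t \<in> carrier G" "fst ws' t \<in> carrier G" "fst ws0 t \<in> carrier G"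
          using A_closed[OF W_A[OF wW[OF _ t]]] wE w0 by blast+
        then show "fst ws t = fst ws' t" using inj(1)[OF t] by (simp add: w_def)
      qed (use wE in \<open>simp_all add: E_def\<close>)
      have "snd ws = snd ws'"
      proof (rule PiE_ext[of _ "{..<k}" "\<lambda>_. center G"])
        fix i assume "i \<in> {..<k}"
        then have i: "i < k" by simp
        have "r ws i \<in> carrier G" "r ws' i \<in> carrier G" "r ws0 i \<in> carrier G"
          using A_closed[OF r(1)[OF _ i]] ES ws0(1) by blast+
        then have "r ws i = r ws' i" using inj(2)[OF i] by (simp add: v_def)
        moreover have "snd ws i \<in> carrier G" "snd ws' i \<in> carrier G" "a (fst ws') i \<in> carrier G"
          using sZ[OF _ i] sS A_closed[OF a(1)[OF wE(2)]] Z.subset by blast+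
        ultimately show "snd ws i = snd ws' i" by (simp add: r_def fst_eq)
      qed (use sS in \<open>simp_all add: S_def\<close>)
      with fst_eq show "ws = ws'" by (rule prod_eqI)
    qed
    then have "card F \<le> card cocycles"
      using datum_cocycle_in_cocycles datum finite_cocycles by (intro card_inj_on_le) auto
    then show ?thesis using EF cardE by simp
  qed
qed

end

section \<open>Comparison of the two bounds on the number of cocycles\<close>

theorem theorem3p5:
  fixes p :: nat and G :: "('a, 'b) monoid_scheme"
  assumes "Factorial_Ring.prime p"
    and "group G"
    and "finite (carrier G)"
    and "\<exists>n. order G = p ^ n"
    and "\<not> comm_group G"
    and "centralizer G (center (G\<lparr>carrier := frattini G\<rparr>)) = frattini G"
    and "(odd p \<and>
           group_rank (G Mod center G)
             < ((min_gens G + 1) choose 2) * min_gens (G\<lparr>carrier := center G\<rparr>)) \<or>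
         (p = 2 \<and>
           group_rank (G Mod center G)
             < (min_gens G choose 2) * min_gens (G\<lparr>carrier := center G\<rparr>))"
  shows "\<exists>\<alpha>\<in>auto G. \<alpha> \<notin> inner_auto G \<and>
           group.ord (AutoGroup G) \<alpha> = p \<and>
           (\<forall>x\<in>frattini G. \<alpha> x = x)"
proof (rule ccontr)
  assume none: "\<not> ?thesis"
  obtain n where n: "order G = p ^ n" using assms(4) ..
  obtain k c base where coords: "frattini_coordinates G p k c base"
    using group.ex_frattini_coordinates[OF assms(2,1) n] by blast
  have "frattini_inner G p k c base"
    using coords assms(6) none
    by (intro frattini_inner.intro frattini_centralizer.intro
        frattini_centralizer_axioms.intro frattini_inner_axioms.intro) blast+
  then interpret frattini_inner G p k c base .
  define z where "z = min_gens (G\<lparr>carrier := center G\<rparr>)"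
  have comm: "comm_group (G\<lparr>carrier := center G\<rparr>)"
    using subgroup_center center_comm
    by (intro group.group_comm_groupI subgroup_imp_group) (auto simp: subgroup.mem_carrier)
  \<comment> \<open>By Lagrange Z(G) has order a power of \<open>p\<close>, so the torsion bound
    applies to it and bounds \<open>card W\<close> below.\<close>
  have "card (center G) dvd p ^ n"
    using lagrange[OF subgroup_center] n by (metis dvd_triv_right)
  then obtain j where "order (G\<lparr>carrier := center G\<rparr>) = p ^ j"
    using prime by (auto simp: divides_primepow_nat order_def)
  then have pz: "p ^ z \<le> card W"
    using comm_group.prime_power_min_gens_le_card_torsion[OF comm prime]
    by (simp add: z_def W_def flip: nat_pow_consistent)
  have "p ^ (card pairs * z) = (p ^ z) ^ card pairs"
    by (simp add: mult.commute flip: power_mult)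
  also have "\<dots> \<le> card W ^ card pairs" using pz by (rule power_mono) simp
  also have "\<dots> \<le> p ^ group_rank (G Mod center G)"
    using card_W_power_le card_cocycles_le by linarith
  finally have "card pairs * z \<le> group_rank (G Mod center G)"
    using prime_gt_1_nat[OF prime] by (simp add: power_increasing_iff)
  \<comment> \<open>The hypothesis is stated with d(G), which is at most \<open>k\<close>;
    monotonicity of the binomial coefficient passes to \<open>card pairs\<close>.\<close>
  moreover have "group_rank (G Mod center G) < card pairs * z"
    using assms(7)
  proof (elim disjE conjE)
    assume "odd p" and less: "group_rank (G Mod center G)
      < ((min_gens G + 1) choose 2) * min_gens (G\<lparr>carrier := center G\<rparr>)"
    have "((min_gens G + 1) choose 2) * z \<le> ((k + 1) choose 2) * z"
      using min_gens_le by (intro mult_le_mono1 binomial_right_mono) simp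
    also have "\<dots> = card pairs * z"
      using \<open>odd p\<close> by (simp add: card_pairs)
    finally show ?thesis using less unfolding z_def by linarith
  next
    assume "p = 2" and less: "group_rank (G Mod center G)
      < (min_gens G choose 2) * min_gens (G\<lparr>carrier := center G\<rparr>)"
    have "(min_gens G choose 2) * z \<le> (k choose 2) * z"
      using min_gens_le by (intro mult_le_mono1 binomial_right_mono)
    also have "\<dots> = card pairs * z"
      unfolding card_pairs using \<open>p = 2\<close> by simp
    finally show ?thesis using less unfolding z_def by linarith
  qed
  ultimately show False by linarith
qed

end
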